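(* Let $F$ be a normed lattice with closed unit ball $B_F$ and universal completion $F^u$, and let $r\ge 1$. The following conditions are equivalent: (i) $F$ is $r$-monotonically complete; (ii) every directed dominable subset of $B_F\cap F_+$ has a supremum in $F$ of norm at most $r$; (iii) $F$ is norm complete and every disjoint $D\subset F_+$ such that $D^{\vee}\subset B_F$ has a supremum in $F$ of norm at most $r$; (iv) the order adherence of $B_F$ in $F^u$ is contained in $rB_F$; (v) every uo-Cauchy net in $B_F$ has a uo-limit in $rB_F$.
   Context: A normed lattice is a real vector lattice with a lattice (solid) norm; norm completeness is not assumed. "Directed" means upward directed. $F$ is $r$-monotonically complete if every directed subset of $B_F\cap F_+$ has a supremum in $F$ of norm at most $r$. For $A\subset F$, $A^{\vee}$ is the set of all suprema of nonempty finite subsets of $A$. $Q\downarrow 0$ means that $Q$ is downward directed with infimum $0$. A net $(f_p)$ in a vector lattice $G$ order converges to $f$ if there is $Q\subset G$ with $Q\downarrow 0$ such that for every $q\in Q$ there is $p_q$ with $|f_p-f|\le q$ whenever $p\ge p_q$. It uo converges to $f$ if $|f_p-f|\wedge e$ order converges to $0$ for every $e\in G_+$. A net $(f_p)_{p\in P}$ is uo-Cauchy if the net $(f_p-f_q)_{(p,q)\in P\times P}$ uo converges to $0$. The order adherence of a set in $G$ is the set of all order limits in $G$ of nets of its elements. A sublattice $E$ of $G$ is order dense if for every $0<g\in G$ there is $e\in E$ with $0<e\le g$. The universal completion $F^u$ is the (essentially unique) universally complete vector lattice, i.e. order (Dedekind) complete and such that every disjoint set of positive elements is order bounded, that contains $F$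 as an order dense sublattice. A subset of $F$ is dominable if it is order bounded in $F^u$. *)

theory Defs
  imports
    "HOL-Analysis.Analysis"
    "HOL-Library.Lattice_Algebras"
    "HOL-Library.Lub_Glb"
begin

section \<open>Vector lattices and normed lattices\<close>

class vector_lattice = ordered_real_vector + lattice_ab_group_add_abs

class normed_lattice = vector_lattice + real_normed_vector +
  assumes norm_solid: "\<bar>x\<bar> \<le> \<bar>y\<bar> \<Longrightarrow> norm x \<le> norm y"

definition upward_directed :: "'a::order set \<Rightarrow> bool" where
  "upward_directed D \<longleftrightarrow> D \<noteq> {} \<and> (\<forall>a\<in>D. \<forall>b\<in>D. \<exists>c\<in>D. a \<le> c \<and> b \<le> c)"

definition decreases_to_zero :: "'a::vector_lattice set \<Rightarrow> bool" where
  "decreases_to_zero Q \<longleftrightarrow>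
     Q \<noteq> {} \<and> (\<forall>a\<in>Q. \<forall>b\<in>Q. \<exists>c\<in>Q. c \<le> a \<and> c \<le> b) \<and> isGlb UNIV Q 0"

definition disjoint_positive :: "'a::vector_lattice set \<Rightarrow> bool" where
  "disjoint_positive D \<longleftrightarrow> D \<subseteq> {0..} \<and> pairwise (\<lambda>a b. inf a b = 0) D"

definition finite_sups :: "'a::lattice set \<Rightarrow> 'a set" where
  "finite_sups A = {Sup_fin B | B. B \<subseteq> A \<and> finite B \<and> B \<noteq> {}}"


section \<open>The universal completion\<close>

definition dedekind_complete :: "'a::vector_lattice itself \<Rightarrow> bool" where
  "dedekind_complete _ \<longleftrightarrow>
     (\<forall>A :: 'a set. A \<noteq> {} \<and> bdd_above A \<longrightarrow> (\<exists>s. isLub UNIV A s))"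

definition universally_complete :: "'a::vector_lattice itself \<Rightarrow> bool" where
  "universally_complete T \<longleftrightarrow>
     dedekind_complete T \<and> (\<forall>D :: 'a set. disjoint_positive D \<longrightarrow> bdd_above D)"

definition order_dense :: "'a::vector_lattice set \<Rightarrow> bool" where
  "order_dense E \<longleftrightarrow> (\<forall>g>0. \<exists>e\<in>E. 0 < e \<and> e \<le> g)"

definition lattice_embedding :: "('a::vector_lattice \<Rightarrow> 'b::vector_lattice) \<Rightarrow> bool" where
  "lattice_embedding J \<longleftrightarrow> linear J \<and> inj J \<and>
     (\<forall>x y. J (sup x y) = sup (J x) (J y)) \<and> (\<forall>x y. J (inf x y) = inf (J x) (J y))"

text \<open>
  The universal completion is unique only up to isomorphism, so it is represented by an
  embedding: \<open>universal_completion J\<close> says that the codomain of \<open>J\<close>, with the domain identified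
  with the sublattice \<open>range J\<close>, is a universal completion of the domain.
\<close>

definition universal_completion :: "('a::vector_lattice \<Rightarrow> 'b::vector_lattice) \<Rightarrow> bool" where
  "universal_completion J \<longleftrightarrow>
     universally_complete TYPE('b) \<and> lattice_embedding J \<and> order_dense (range J)"

definition dominable :: "('a::vector_lattice \<Rightarrow> 'b::vector_lattice) \<Rightarrow> 'a set \<Rightarrow> bool" where
  "dominable J A \<longleftrightarrow> bdd_below (J ` A) \<and> bdd_above (J ` A)"


section \<open>Nets, order convergence and uo convergence\<close>

text \<open>
  A net is a function restricted to an index set \<open>P\<close> that is directed by a preorder \<open>le\<close>; \<open>P\<close> and
  \<open>le\<close> are unrelated to any order on the type of indices.
\<close>

definition directed_index :: "'i set \<Rightarrow> ('i \<Rightarrow> 'i \<Rightarrow> bool) \<Rightarrow> bool" where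
  "directed_index P le \<longleftrightarrow> P \<noteq> {} \<and> reflp_on P le \<and> transp_on P le \<and>
     (\<forall>p\<in>P. \<forall>q\<in>P. \<exists>s\<in>P. le p s \<and> le q s)"

definition order_converges ::
    "'i set \<Rightarrow> ('i \<Rightarrow> 'i \<Rightarrow> bool) \<Rightarrow> ('i \<Rightarrow> 'a::vector_lattice) \<Rightarrow> 'a \<Rightarrow> bool" where
  "order_converges P le x l \<longleftrightarrow>
     (\<exists>Q. decreases_to_zero Q \<and>
        (\<forall>q\<in>Q. \<exists>p\<^sub>q\<in>P. \<forall>p\<in>P. le p\<^sub>q p \<longrightarrow> \<bar>x p - l\<bar> \<le> q))"

definition uo_converges ::
    "'i set \<Rightarrow> ('i \<Rightarrow> 'i \<Rightarrow> bool) \<Rightarrow> ('i \<Rightarrow> 'a::vector_lattice) \<Rightarrow> 'a \<Rightarrow> bool" where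
  "uo_converges P le x l \<longleftrightarrow>
     (\<forall>e\<ge>0. order_converges P le (\<lambda>p. inf \<bar>x p - l\<bar> e) 0)"

definition uo_Cauchy ::
    "'i set \<Rightarrow> ('i \<Rightarrow> 'i \<Rightarrow> bool) \<Rightarrow> ('i \<Rightarrow> 'a::vector_lattice) \<Rightarrow> bool" where
  "uo_Cauchy P le x \<longleftrightarrow>
     uo_converges (P \<times> P) (\<lambda>(p, q) (p', q'). le p p' \<and> le q q') (\<lambda>(p, q). x p - x q) 0"

text \<open>
  HOL cannot quantify over all index types inside a formula, so the order adherence carries the
  type \<open>'i\<close> from which index sets are drawn. A statement about nets in a normed lattice \<open>'f\<close>
  that uses the index type \<open>'j + 'f\<close>, with \<open>'j\<close> a free type variable, loses nothing: every index
  set is a subset of such a type for a suitable \<open>'j\<close>, and for every \<open>'j\<close> the type contains a copy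
  of each subset of \<open>'f\<close>, so that directed subsets of \<open>'f\<close> can serve as their own index sets.
\<close>

definition order_adherence :: "'i itself \<Rightarrow> 'a::vector_lattice set \<Rightarrow> 'a set" where
  "order_adherence _ A =
     {l. \<exists>(P :: 'i set) le x. directed_index P le \<and> x ` P \<subseteq> A \<and> order_converges P le x l}"


section \<open>Monotone completeness\<close>

definition monotonically_complete :: "real \<Rightarrow> 'a::normed_lattice itself \<Rightarrow> bool" where
  "monotonically_complete r _ \<longleftrightarrow>
     (\<forall>D :: 'a set. upward_directed D \<and> D \<subseteq> cball 0 1 \<inter> {0..} \<longrightarrow>
        (\<exists>s. isLub UNIV D s \<and> norm s \<le> r))"

end

theory Submission
  imports Defs
begin

text \<open>
  If a directed \<open>D \<subseteq> B\<^sub>F \<inter> F\<^sub>+\<close> is unbounded in \<open>F\<^sup>u\<close>, there is \<open>0 < f \<in> F\<close> such that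
  \<open>{d \<sqinter> n f | d \<in> D}\<close> has supremum \<open>n f\<close> for every \<open>n\<close>; these sets are dominable, so (ii) bounds
  \<open>\<parallel>n f\<parallel>\<close> by \<open>r\<close> for all \<open>n\<close>, which is absurd. Hence (ii) implies (i), and it suffices that each
  of (iii), (iv), (v) follows from (i) and implies (ii).

  For (iii), let \<open>u\<close> be the supremum of \<open>D\<close> in \<open>F\<^sup>u\<close>. Suprema of disjoint sets give enough principal
  band projections of elements of \<open>D\<close> to find, for \<open>t < 1\<close>, a maximal disjoint set of such
  projections, each at least \<open>t u\<close> on its own band; its supremum lies between \<open>t u\<close> and \<open>u\<close>. As
  \<open>t \<rightarrow> 1\<close> these suprema form a norm Cauchy sequence whose limit is \<open>u\<close>.

  For (iv) and (v), both the modulus of an order limit and the limit of a positive uo-Cauchy net are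
  suprema of directed sets of elements of \<open>F\<^sub>+\<close> below members of the net. Conversely, a dominable
  directed set is a net that order converges in \<open>F\<^sup>u\<close> to its supremum and is uo-Cauchy in \<open>F\<close>.
\<close>

section \<open>Suprema and disjointness in vector lattices\<close>

declare neg_inf_eq_sup [simp del] neg_sup_eq_inf [simp del]
  diff_inf_eq_sup [simp del] diff_sup_eq_inf [simp del]

lemma isLub_UNIV_iff:
  "isLub UNIV A s \<longleftrightarrow> (\<forall>a\<in>A. a \<le> s) \<and> (\<forall>z. (\<forall>a\<in>A. a \<le> z) \<longrightarrow> s \<le> z)"
  by (auto simp: isLub_def leastP_def isUb_def setle_def setge_def)

lemma isGlb_UNIV_iff:
  "isGlb UNIV A s \<longleftrightarrow> (\<forall>a\<in>A. s \<le> a) \<and> (\<forall>z. (\<forall>a\<in>A. z \<le> a) \<longrightarrow> z \<le> s)"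
  by (auto simp: isGlb_def greatestP_def isLb_def setle_def setge_def)

lemma isLub_UNIV_unique:
  fixes s t :: "'a::order"
  shows "isLub UNIV A s \<Longrightarrow> isLub UNIV A t \<Longrightarrow> s = t"
  by (auto simp: isLub_UNIV_iff intro: antisym)

lemma inf_le_inf_add:
  fixes a b e :: "'a::vector_lattice"
  assumes "a \<le> b"
  shows "inf b e \<le> inf a e + (b - a)"
proof -
  have "inf a e + (b - a) = inf b (e + (b - a))"
    by (simp add: add_inf_distrib_right)
  moreover have "inf b e \<le> inf b (e + (b - a))"
    using assms by (intro inf_mono) auto
  ultimately show ?thesis by simp
qed

text \<open>Truncation at \<open>e\<close> grows no faster than its argument,
  \<open>inf s e - inf a e \<le> s - a\<close>, so a bound \<open>q\<close> on all truncations makes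
  \<open>s - inf s e + q\<close> an upper bound of \<open>A\<close>. This is the infinite
  distributive law as an inequality.\<close>

lemma isLub_inf_le:
  fixes s :: "'a::vector_lattice"
  assumes s: "isLub UNIV A s" and q: "\<And>a. a \<in> A \<Longrightarrow> inf a e \<le> q"
  shows "inf s e \<le> q"
proof -
  have "a \<le> s - inf s e + q" if "a \<in> A" for a
  proof -
    have "inf s e \<le> inf a e + (s - a)"
      using that s by (intro inf_le_inf_add) (auto simp: isLub_UNIV_iff)
    also have "\<dots> \<le> q + (s - a)" using q[OF that] by simp
    finally show ?thesis by (simp add: algebra_simps)
  qed
  then have "s \<le> s - inf s e + q" using s by (auto simp: isLub_UNIV_iff)
  then show ?thesis by (simp add: algebra_simps)
qed

text \<open>Fix an element of \<open>B\<close> to bound \<open>s\<close>, then bound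
  \<open>t\<close>. The arbitrary \<open>z\<close> takes the place of the set of all sums, which
  need not be formed.\<close>

lemma isLub_add:
  fixes s t :: "'a::vector_lattice"
  assumes s: "isLub UNIV A s" and t: "isLub UNIV B t" and z: "\<And>a b. a \<in> A \<Longrightarrow> b \<in> B \<Longrightarrow> a + b \<le> z"
  shows "s + t \<le> z"
proof -
  have "s \<le> z - b" if "b \<in> B" for b
  proof -
    have "a \<le> z - b" if "a \<in> A" for a using z[OF that \<open>b \<in> B\<close>] by (simp add: algebra_simps)
    then show ?thesis using s by (auto simp: isLub_UNIV_iff)
  qed
  then have "b \<le> z - s" if "b \<in> B" for b using that by (simp add: algebra_simps)
  then have "t \<le> z - s" using t by (auto simp: isLub_UNIV_iff)
  then show ?thesis by (simp add: algebra_simps)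
qed

lemma inf_add_le:
  fixes a b c :: "'a::vector_lattice"
  assumes "0 \<le> a" "0 \<le> b" "0 \<le> c"
  shows "inf (a + b) c \<le> inf a c + inf b c"
proof -
  have "inf a c + inf b c = inf (inf (a + b) (c + b)) (inf (a + c) (c + c))"
    by (simp add: add_inf_distrib_right add_inf_distrib_left inf_assoc)
  moreover have "inf (a + b) c \<le> \<dots>"
    using assms by (auto simp: le_infI2 add_increasing add_increasing2)
  ultimately show ?thesis by simp
qed

text \<open>\<open>c\<close> splits into its part below \<open>b\<close> and its excess over
  \<open>b\<close>. Later inductions fit a multiple of an element below the first part and one more
  copy below the second, so that all multiples stay below \<open>c\<close>.\<close>

lemma inf_add_pprt_diff: "inf c b + pprt (c - b) = (c::'a::vector_lattice)"
proof -
  have "pprt (c - b) = sup c b - b"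
    by (simp add: pprt_def add_sup_distrib_right diff_conv_add_uminus del: add_uminus_conv_diff)
  moreover have "inf c b = c + b - sup c b" using add_eq_inf_sup[of c b] by simp
  ultimately show ?thesis by simp
qed

lemma diff_inf_eq_pprt: "c - inf c b = pprt (c - (b::'a::vector_lattice))"
  using inf_add_pprt_diff[of c b] by (metis add_diff_cancel_left')

lemma inf_pprt_pprt_neg: "inf (pprt x) (pprt (- x)) = (0::'a::vector_lattice)"
proof -
  have "inf (pprt x) (pprt (- x)) = inf (x - nprt x) (0 - nprt x)"
    using prts[of x] by (metis add_diff_cancel_right' diff_0 pprt_neg)
  also have "\<dots> = inf x 0 - nprt x"
    by (simp only: diff_conv_add_uminus add_inf_distrib_right)
  finally show ?thesis by (simp add: nprt_def)
qed

lemma inf_scaleR_eq_0: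
  fixes a b :: "'a::vector_lattice"
  assumes "inf a b = 0" "0 \<le> k"
  shows "inf a (k *\<^sub>R b) = 0"
proof (rule antisym)
  have ab: "0 \<le> a" "0 \<le> b" using assms(1) by (metis inf_le1 inf_le2)+
  show "0 \<le> inf a (k *\<^sub>R b)" using ab assms by (simp add: scaleR_nonneg_nonneg)
  \<comment> \<open>Dividing by this \<open>m\<close> brings both \<open>a\<close> and
    \<open>k *\<^sub>R b\<close> below \<open>a\<close> and \<open>b\<close>, since
    \<open>inverse m \<le> 1\<close> and \<open>inverse m * k \<le> 1\<close>.\<close>
  define m where "m = max 1 k"
  have m: "m \<ge> 1" "m \<ge> k" by (auto simp: m_def)
  have *: "inverse m *\<^sub>R inf a (k *\<^sub>R b) \<le> inf a b"
  proof (rule inf_greatest)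
    have "inverse m *\<^sub>R inf a (k *\<^sub>R b) \<le> inverse m *\<^sub>R a" 
      using m by (intro scaleR_left_mono) auto
    also have "\<dots> \<le> 1 *\<^sub>R a" using m ab by (intro scaleR_right_mono) (auto simp: field_simps)
    finally show "inverse m *\<^sub>R inf a (k *\<^sub>R b) \<le> a" by simp
    have "inverse m *\<^sub>R inf a (k *\<^sub>R b) \<le> inverse m *\<^sub>R (k *\<^sub>R b)" 
      using m by (intro scaleR_left_mono) auto
    also have "\<dots> = (inverse m * k) *\<^sub>R b" by simp
    also have "\<dots> \<le> 1 *\<^sub>R b" using m ab by (intro scaleR_right_mono) (auto simp: field_simps)
    finally show "inverse m *\<^sub>R inf a (k *\<^sub>R b) \<le> b" by simp
  qed
  have "m *\<^sub>R (inverse m *\<^sub>R inf a (k *\<^sub>R b)) \<le> m *\<^sub>R inf a b"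
    using * m by (intro scaleR_left_mono) auto
  then show "inf a (k *\<^sub>R b) \<le> 0" using m assms by simp
qed

lemma disjoint_mono:
  fixes a b :: "'a::vector_lattice"
  assumes "inf a b = 0" "0 \<le> a'" "a' \<le> a" "0 \<le> b'" "b' \<le> b"
  shows "inf a' b' = 0"
  by (metis assms inf.bounded_iff inf_mono order_antisym)

text \<open>If \<open>w\<close> is disjoint from the excess of \<open>a\<close> over
  \<open>c\<close>, then \<open>a\<close> does not exceed \<open>c\<close> on the band of
  \<open>w\<close>, and every truncation by a multiple of \<open>w\<close> lies in that
  band.\<close>

lemma inf_scaleR_le_of_disjoint:
  fixes a c w :: "'a::vector_lattice"
  assumes "inf (pprt (a - c)) w = 0" "0 \<le> c" "0 \<le> k"
  shows "inf a (k *\<^sub>R w) \<le> c"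
proof -
  have w: "0 \<le> w" using assms(1) by (metis inf_le2)
  have kw: "0 \<le> k *\<^sub>R w" using w assms by (simp add: scaleR_nonneg_nonneg)
  have "a \<le> pprt (a - c) + c" 
    by (metis inf_add_pprt_diff add.commute add_left_mono inf_le2)
  then have "inf a (k *\<^sub>R w) \<le> inf (pprt (a - c) + c) (k *\<^sub>R w)" by (intro inf_mono) auto
  also have "\<dots> \<le> inf (pprt (a - c)) (k *\<^sub>R w) + inf c (k *\<^sub>R w)"
    using assms kw by (intro inf_add_le) auto
  also have "\<dots> = inf c (k *\<^sub>R w)" using inf_scaleR_eq_0[OF assms(1,3)] by simp
  finally show ?thesis by simp
qed

text \<open>Shifting the index shows that the supremum \<open>s\<close> of the multiples of
  \<open>h\<close> satisfies \<open>s \<le> s - h\<close>.\<close>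

lemma dedekind_complete_archimedean:
  fixes h c :: "'a::vector_lattice"
  assumes "dedekind_complete TYPE('a)" and le: "\<And>n::nat. of_nat n *\<^sub>R h \<le> c"
  shows "h \<le> 0"
proof -
  have "bdd_above (range (\<lambda>n::nat. of_nat n *\<^sub>R h))" using le by (auto intro!: bdd_aboveI)
  then obtain s where s: "isLub UNIV (range (\<lambda>n::nat. of_nat n *\<^sub>R h)) s"
    using assms(1) by (auto simp: dedekind_complete_def)
  have "of_nat n *\<^sub>R h \<le> s - h" for n :: nat
  proof -
    have "of_nat (Suc n) *\<^sub>R h \<le> s" using s unfolding isLub_UNIV_iff by blast
    then show ?thesis by (simp add: algebra_simps)
  qed
  then have "s \<le> s - h" using s by (auto simp: isLub_UNIV_iff)
  then show ?thesis by simp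
qed

text \<open>A converse of \<open>inf_scaleR_le_of_disjoint\<close>: if \<open>c\<close> does not
  exceed \<open>b\<close> on the band of \<open>w\<close>, the excess is disjoint from
  \<open>w\<close>. A common minorant \<open>h\<close> of both would have all its multiples below
  \<open>c\<close>, each step adding a copy of \<open>h\<close> from the excess to a multiple below
  \<open>inf c b\<close>.\<close>

lemma disjoint_excess:
  fixes b c w :: "'a::vector_lattice"
  assumes dc: "dedekind_complete TYPE('a)" and "0 \<le> c" "0 \<le> w"
    and b: "\<And>k::nat. inf c (of_nat k *\<^sub>R w) \<le> b"
  shows "inf (pprt (c - b)) w = 0"
proof -
  define h where "h = inf (pprt (c - b)) w"
  have "of_nat k *\<^sub>R h \<le> c" for k :: nat
  proof (induction k)
    case (Suc k)
    have "of_nat k *\<^sub>R h \<le> of_nat k *\<^sub>R w" by (intro scaleR_left_mono) (auto simp: h_def)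
    then have "of_nat k *\<^sub>R h \<le> inf c b" using Suc b[of k] by (meson le_inf_iff order_trans)
    moreover have "h \<le> pprt (c - b)" by (simp add: h_def)
    ultimately have "of_nat k *\<^sub>R h + h \<le> inf c b + pprt (c - b)" by (rule add_mono)
    then show ?case by (simp add: inf_add_pprt_diff algebra_simps)
  qed (use assms in simp)
  then have "h \<le> 0" by (rule dedekind_complete_archimedean[OF dc])
  moreover have "0 \<le> h" using assms by (simp add: h_def)
  ultimately show ?thesis unfolding h_def by (rule antisym)
qed

text \<open>Zorn's lemma, with maximality phrased for single elements. When \<open>S\<close>
  consists of strictly positive elements, a member of \<open>S\<close> disjoint from all of
  \<open>M\<close> would belong to \<open>M\<close> and be disjoint from itself; later
  contradictions arise in this way.\<close>

lemma maximal_disjoint_subset: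
  fixes S :: "'a::vector_lattice set"
  obtains M where "M \<subseteq> S" "pairwise (\<lambda>a b. inf a b = 0) M"
    "\<And>x. x \<in> S \<Longrightarrow> (\<And>m. m \<in> M \<Longrightarrow> inf x m = 0) \<Longrightarrow> x \<in> M"
proof -
  let ?A = "{M. M \<subseteq> S \<and> pairwise (\<lambda>a b. inf a b = 0) M}"
  have "\<exists>M\<in>?A. \<forall>X\<in>?A. M \<subseteq> X \<longrightarrow> X = M"
  proof (rule subset_Zorn')
    fix C assume C: "subset.chain ?A C"
    have "pairwise (\<lambda>a b. inf a b = 0) (\<Union>C)"
      using C by (intro pairwise_chain_Union) (auto simp: subset_chain_def chain_subset_def)
    then show "\<Union>C \<in> ?A" using C by (auto simp: subset_chain_def)
  qed
  then obtain M where M: "M \<in> ?A" and max: "\<forall>X\<in>?A. M \<subseteq> X \<longrightarrow> X = M" by (rule bexE)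
  show thesis
  proof (rule that)
    fix x assume x: "x \<in> S" "\<And>m. m \<in> M \<Longrightarrow> inf x m = 0"
    have "insert x M \<in> ?A" using M x by (auto simp: pairwise_def inf_commute)
    with max have "insert x M = M" by (meson subset_insertI)
    then show "x \<in> M" by auto
  qed (use M in auto)
qed

section \<open>Suprema of bounded sets and truncations of unbounded sets\<close>

lemma dedekind_complete_lub:
  fixes A :: "'a::vector_lattice set"
  assumes "dedekind_complete TYPE('a)" "A \<noteq> {}" "\<And>a. a \<in> A \<Longrightarrow> a \<le> c"
  shows "\<exists>s. isLub UNIV A s"
  using assms unfolding dedekind_complete_def bdd_above_def by blast

lemma pprt_pos: "\<not> d \<le> b \<Longrightarrow> 0 < pprt (d - (b::'a::vector_lattice))"
  by (metis diff_le_0_iff_le le_zero_iff_zero_pprt zero_le_pprt order_le_less)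

text \<open>
  Otherwise every \<open>u > 0\<close> dominates a multiple of some \<open>w > 0\<close> on whose band \<open>D\<close> is bounded. The
  least upper bounds on the bands of a maximal disjoint family of such \<open>w\<close> are disjoint, hence
  bounded, and their common bound is a bound of \<open>D\<close>.
\<close>
lemma unbounded_subset:
  fixes D :: "'a::vector_lattice set"
  assumes uc: "universally_complete TYPE('a)" and D: "D \<subseteq> {0..}" and "\<not> bdd_above D"
  obtains u where "u > 0"
    "\<And>n::nat. isLub UNIV ((\<lambda>d. inf d (of_nat n *\<^sub>R u)) ` D) (of_nat n *\<^sub>R u)"
proof (rule ccontr)
  note outer = that
  assume neg: "\<not> thesis"
  have no: "\<exists>n::nat. \<not> isLub UNIV ((\<lambda>d. inf d (of_nat n *\<^sub>R u)) ` D) (of_nat n *\<^sub>R u)" if "u > 0" for u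
    using outer[OF that] neg by blast
  have dc: "dedekind_complete TYPE('a)" using uc by (simp add: universally_complete_def)
  have Dne: "D \<noteq> {}" using assms(3) by auto
  define S where "S = {w. 0 < w \<and> (\<exists>c. \<forall>d\<in>D. \<forall>k::nat. inf d (of_nat k *\<^sub>R w) \<le> c)}"
  obtain M where M: "M \<subseteq> S" "pairwise (\<lambda>a b. inf a b = 0) M"
    and max: "\<And>x. x \<in> S \<Longrightarrow> (\<And>m. m \<in> M \<Longrightarrow> inf x m = 0) \<Longrightarrow> x \<in> M"
    using maximal_disjoint_subset[of S] by blast
  \<comment> \<open>The elements of \<open>B w\<close> lie in the band of \<open>w\<close>; their
    supremum \<open>s w\<close> is the least upper bound of \<open>D\<close> on this band.\<close>
  define B where "B w = {inf d (of_nat k *\<^sub>R w) | d k. d \<in> D \<and> k \<in> (UNIV::nat set)}" for w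
  have "\<exists>s. isLub UNIV (B w) s" if w: "w \<in> M" for w
  proof -
    obtain c where "\<forall>d\<in>D. \<forall>k::nat. inf d (of_nat k *\<^sub>R w) \<le> c"
      using w M(1) unfolding S_def by blast
    then have "\<And>a. a \<in> B w \<Longrightarrow> a \<le> c" by (auto simp: B_def)
    moreover have "B w \<noteq> {}" using Dne by (auto simp: B_def)
    ultimately show ?thesis using dedekind_complete_lub[OF dc] by blast
  qed
  then have "\<forall>w. \<exists>s. w \<in> M \<longrightarrow> isLub UNIV (B w) s" by blast
  from choice[OF this] obtain s where s: "\<And>w. w \<in> M \<Longrightarrow> isLub UNIV (B w) (s w)" by blast
  have Bs: "inf d (of_nat k *\<^sub>R w) \<le> s w" if "w \<in> M" "d \<in> D" for d w and k :: nat
    using s[OF that(1)] that(2) by (auto simp: isLub_UNIV_iff B_def)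
  have s0: "0 \<le> s w" if "w \<in> M" for w
  proof -
    obtain d where d: "d \<in> D" using Dne by auto
    show ?thesis using Bs[OF that d, of 0] D d by (auto simp: inf_absorb2)
  qed
  have sd: "inf (s w) (s w') = 0" if w: "w \<in> M" "w' \<in> M" "w \<noteq> w'" for w w'
  proof (rule antisym)
    have ww: "inf w w' = 0" using M(2) w by (auto simp: pairwise_def)
    have *: "inf (inf d (of_nat k *\<^sub>R w)) (inf d' (of_nat k' *\<^sub>R w')) \<le> 0" for d d' and k k' :: nat
    proof -
      have "inf (of_nat k *\<^sub>R w) (of_nat k' *\<^sub>R w') = 0"
        using inf_scaleR_eq_0[OF inf_scaleR_eq_0[OF ww, of "of_nat k'", unfolded inf_commute[of w]], of "of_nat k"]
        by (simp add: inf_commute)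
      moreover have "inf (inf d (of_nat k *\<^sub>R w)) (inf d' (of_nat k' *\<^sub>R w')) \<le> 
          inf (of_nat k *\<^sub>R w) (of_nat k' *\<^sub>R w')" by (intro inf_mono) auto
      ultimately show ?thesis by simp
    qed
    show "inf (s w) (s w') \<le> 0"
    proof (rule isLub_inf_le[OF s[OF w(1)]])
      fix a assume a: "a \<in> B w"
      have "inf (s w') a \<le> 0"
      proof (rule isLub_inf_le[OF s[OF w(2)]])
        fix a' assume "a' \<in> B w'"
        then have "inf a a' \<le> 0" using a * by (auto simp: B_def)
        then show "inf a' a \<le> 0" by (simp add: inf_commute)
      qed
      then show "inf a (s w') \<le> 0" by (simp add: inf_commute)
    qed
    show "0 \<le> inf (s w) (s w')" using s0 w by simp
  qed
  have "disjoint_positive (s ` M)"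
    using s0 sd by (auto simp: disjoint_positive_def pairwise_def)
  then have "bdd_above (s ` M)" using uc by (simp add: universally_complete_def)
  then obtain b0 where b0: "\<And>w. w \<in> M \<Longrightarrow> s w \<le> b0" by (auto simp: bdd_above_def)
  define b where "b = sup b0 0"
  have b: "s w \<le> b" if "w \<in> M" for w using b0[OF that] by (simp add: b_def le_supI1)
  have "d \<le> b" if d: "d \<in> D" for d
  proof (rule ccontr)
    assume "\<not> d \<le> b"
    then have e: "0 < pprt (d - b)" by (rule pprt_pos)
    define e where "e = pprt (d - b)"
    \<comment> \<open>On the band of each \<open>w\<close> in \<open>M\<close> the set
      \<open>D\<close> is bounded by \<open>b\<close>, so the excess \<open>e\<close> of
      \<open>d\<close> over \<open>b\<close> does not meet that band.\<close>
    have eM: "inf e w = 0" if w: "w \<in> M" for w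
      unfolding e_def
    proof (rule disjoint_excess[OF dc])
      show "0 \<le> d" using d D by auto
      show "0 \<le> w" using w M(1) by (auto simp: S_def intro: less_imp_le)
      show "inf d (of_nat k *\<^sub>R w) \<le> b" for k :: nat
        using Bs[OF w d] b[OF w] by (rule order_trans)
    qed
    obtain n :: nat where n: "\<not> isLub UNIV ((\<lambda>d. inf d (of_nat n *\<^sub>R e)) ` D) (of_nat n *\<^sub>R e)"
      using no[of e] e by (auto simp: e_def)
    define c where "c = of_nat n *\<^sub>R e"
    have c0: "0 \<le> c" by (simp add: c_def e_def scaleR_nonneg_nonneg)
    obtain v where v: "isLub UNIV ((\<lambda>d. inf d c) ` D) v"
      using dedekind_complete_lub[OF dc, of "(\<lambda>d. inf d c) ` D" c] Dne by force
    have "v \<le> c" using v by (auto simp: isLub_UNIV_iff)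
    moreover have "v \<noteq> c" using n v by (auto simp: c_def)
    ultimately have w0: "0 < c - v" by simp
    have "0 \<le> v"
    proof -
      have "0 \<le> inf d c" using d D c0 by auto
      also have "inf d c \<le> v" using v d by (auto simp: isLub_UNIV_iff)
      finally show ?thesis .
    qed
    \<comment> \<open>The truncations of \<open>D\<close> at \<open>c\<close> fall short of
      \<open>c\<close> by \<open>c - v\<close>. On the band of this gap no element of
      \<open>D\<close> exceeds \<open>c\<close>, so the gap belongs to \<open>S\<close>; lying below
      a multiple of \<open>e\<close>, it is also disjoint from \<open>M\<close>.\<close>
    have "inf d' (of_nat k *\<^sub>R (c - v)) \<le> c" if d': "d' \<in> D" for d' and k :: nat
    proof (rule inf_scaleR_le_of_disjoint[OF _ c0])
      have "inf d' c \<le> v" using v d' by (auto simp: isLub_UNIV_iff)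
      then have "c - v \<le> pprt (- (d' - c))" 
        using diff_inf_eq_pprt[of c d', symmetric] by (simp add: inf_commute)
      then show "inf (pprt (d' - c)) (c - v) = 0"
        using w0 by (intro disjoint_mono[OF inf_pprt_pprt_neg[of "d' - c"]]) (auto intro: less_imp_le)
    qed simp
    then have "c - v \<in> S" using w0 by (auto simp: S_def)
    moreover have "inf (c - v) m = 0" if m: "m \<in> M" for m
    proof -
      have mc: "inf m c = 0" unfolding c_def using eM[OF m] by (intro inf_scaleR_eq_0) (auto simp: inf_commute)
      moreover have "0 \<le> m" using m M(1) by (auto simp: S_def intro: less_imp_le)
      ultimately have "inf m (c - v) = 0"
        using w0 \<open>0 \<le> v\<close> by (intro disjoint_mono[OF mc]) (auto intro: less_imp_le)
      then show ?thesis by (simp add: inf_commute)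
    qed
    ultimately have "c - v \<in> M" "\<And>m. m \<in> M \<Longrightarrow> inf (c - v) m = 0" using max by blast+
    then have "inf (c - v) (c - v) = 0" by blast
    then show False using w0 by simp
  qed
  then show False using assms(3) by (auto simp: bdd_above_def)
qed

section \<open>Normed lattices and embeddings into the universal completion\<close>

lemma norm_abs_eq: "norm \<bar>x\<bar> = norm (x::'a::normed_lattice)"
  by (intro antisym norm_solid) simp_all

lemma norm_mono_pos: "0 \<le> x \<Longrightarrow> x \<le> y \<Longrightarrow> norm x \<le> norm (y::'a::normed_lattice)"
  by (intro norm_solid) (simp add: order_trans[of 0 x y])

text \<open>The map \<open>x \<mapsto> sup x c\<close> is nonexpansive. With \<open>c = 0\<close>
  this transfers the uo-Cauchy property to positive and negative parts.\<close>

lemma abs_sup_sup_le: "\<bar>sup a c - sup b c\<bar> \<le> \<bar>a - (b::'a::vector_lattice)\<bar>"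
proof -
  have *: "sup a c \<le> sup b c + \<bar>a - b\<bar>" for a b :: 'a
  proof (rule le_supI)
    have "a = b + (a - b)" by simp
    also have "\<dots> \<le> sup b c + \<bar>a - b\<bar>" by (intro add_mono) (auto simp: abs_ge_self)
    finally show "a \<le> sup b c + \<bar>a - b\<bar>" .
    show "c \<le> sup b c + \<bar>a - b\<bar>" by (simp add: add_increasing2)
  qed
  show ?thesis
    using *[of a b] *[of b a] by (intro abs_leI) (simp_all add: algebra_simps abs_minus_commute)
qed

text \<open>Order intervals are norm closed: the positive part of \<open>a - l\<close> is eventually
  dominated by \<open>\<bar>x n - l\<bar>\<close>, so its norm vanishes.\<close>

lemma tendsto_ge_normed_lattice:
  fixes x :: "nat \<Rightarrow> 'a::normed_lattice"
  assumes x: "x \<longlonglongrightarrow> l" and ge: "eventually (\<lambda>n. a \<le> x n) sequentially"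
  shows "a \<le> l"
proof -
  have lim: "(\<lambda>n. norm (x n - l)) \<longlonglongrightarrow> 0" using x by (simp add: LIM_zero tendsto_norm_zero)
  have "eventually (\<lambda>n. norm (pprt (a - l)) \<le> norm (x n - l)) sequentially"
    using ge
  proof eventually_elim
    case (elim n)
    have "pprt (a - l) \<le> pprt (x n - l)" using elim by (intro pprt_mono) simp
    also have "\<dots> \<le> \<bar>x n - l\<bar>" by (simp add: pprt_def abs_ge_self)
    finally show ?case by (intro norm_solid) simp
  qed
  from tendsto_lowerbound[OF lim this] have "norm (pprt (a - l)) \<le> 0" by simp
  then show ?thesis by (simp flip: le_zero_iff_zero_pprt)
qed

section \<open>Suprema under the embedding into the universal completion\<close>

locale universal_completion_embedding =
  fixes J :: "'f::vector_lattice \<Rightarrow> 'u::vector_lattice"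
  assumes uc: "universal_completion J"
begin

lemma J_dedekind: "dedekind_complete TYPE('u)"
  using uc by (simp add: universal_completion_def universally_complete_def)

lemma bounded_lub: "A \<noteq> {} \<Longrightarrow> bdd_above A \<Longrightarrow> \<exists>s. isLub UNIV (A :: 'u set) s"
  using J_dedekind by (simp add: dedekind_complete_def)

lemma J_linear: "linear J" and J_inj: "inj J"
  and J_sup: "J (sup x y) = sup (J x) (J y)" and J_inf: "J (inf x y) = inf (J x) (J y)"
  using uc by (auto simp: universal_completion_def lattice_embedding_def)

lemma J_add: "J (x + y) = J x + J y" and J_diff: "J (x - y) = J x - J y"
  and J_minus: "J (- x) = - J x" and J_0: "J 0 = 0" and J_scale: "J (c *\<^sub>R x) = c *\<^sub>R J x"
  using J_linear by (simp_all add: linear_add linear_diff linear_neg linear_0 linear_scale)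

lemma J_abs: "J \<bar>x\<bar> = \<bar>J x\<bar>" by (simp add: abs_lattice J_sup J_minus)

lemma J_pprt: "J (pprt x) = pprt (J x)" by (simp add: pprt_def J_sup J_0)

lemma J_le_iff: "J x \<le> J y \<longleftrightarrow> x \<le> y"
  using J_inf[of x y] J_inj by (metis injD inf.absorb_iff1)

lemma J_ge_0_iff: "0 \<le> J y \<longleftrightarrow> 0 \<le> y" using J_le_iff[of 0 y] by (simp add: J_0)

lemma J_dense: 
  assumes "0 < u" obtains f where "0 < f" "J f \<le> u"
proof -
  obtain f where "0 < J f" "J f \<le> u"
    using uc assms by (auto simp: universal_completion_def order_dense_def)
  then show thesis using that[of f] J_le_iff[of f 0] J_ge_0_iff[of f] by (simp add: less_le_not_le J_0)
qed

text \<open>Order density makes the embedding preserve existing suprema. If \<open>z\<close> were an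
  upper bound of the image not above \<open>J s\<close>, some \<open>f > 0\<close> would fit below
  the excess of \<open>J s\<close> over \<open>z\<close>, and \<open>s - f\<close> would still bound
  \<open>A\<close>.\<close>

lemma isLub_image:
  assumes s: "isLub UNIV A s" shows "isLub UNIV (J ` A) (J s)"
proof (unfold isLub_UNIV_iff, intro conjI allI impI)
  show "\<forall>a\<in>J ` A. a \<le> J s" using s by (auto simp: isLub_UNIV_iff J_le_iff)
  fix z assume z: "\<forall>a\<in>J ` A. a \<le> z"
  show "J s \<le> z"
  proof (rule ccontr)
    assume "\<not> J s \<le> z"
    then obtain f where f: "0 < f" "J f \<le> pprt (J s - z)" using J_dense[OF pprt_pos] by blast
    have "a \<le> s - f" if a: "a \<in> A" for a
    proof -
      have "J a \<le> inf (J s) z" using z s a by (auto simp: isLub_UNIV_iff J_le_iff)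
      then have "J a + J f \<le> inf (J s) z + pprt (J s - z)" using f(2) by (rule add_mono)
      then have "J (a + f) \<le> J s" by (simp add: inf_add_pprt_diff J_add)
      then show ?thesis by (simp add: J_le_iff algebra_simps)
    qed
    then have "s \<le> s - f" using s by (auto simp: isLub_UNIV_iff)
    then show False using f(1) by simp
  qed
qed

lemma isLub_of_image: "isLub UNIV (J ` A) (J s) \<Longrightarrow> isLub UNIV A s"
  by (auto simp: isLub_UNIV_iff J_le_iff) (metis J_le_iff)

text \<open>If \<open>z\<close> bounds all minorants but not \<open>u\<close>, some
  \<open>f > 0\<close> fits below the excess of \<open>u\<close> over \<open>z\<close>. Each
  multiple of \<open>f\<close> is then a minorant of \<open>u\<close>, hence below \<open>z\<close>,
  and leaves room for one more copy, against the Archimedean property.\<close>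

lemma isLub_minorants:
  assumes "0 \<le> u" shows "isLub UNIV (J ` {f. 0 \<le> f \<and> J f \<le> u}) u"
proof (unfold isLub_UNIV_iff, intro conjI allI impI)
  fix z assume z: "\<forall>a\<in>J ` {f. 0 \<le> f \<and> J f \<le> u}. a \<le> z"
  show "u \<le> z"
  proof (rule ccontr)
    assume "\<not> u \<le> z"
    then obtain f where f: "0 < f" "J f \<le> pprt (u - z)" using J_dense[OF pprt_pos] by blast
    have "J (of_nat n *\<^sub>R f) \<le> u" for n :: nat
    proof (induction n)
      case (Suc n)
      then have "J (of_nat n *\<^sub>R f) \<le> inf u z" 
        using z f(1) by (auto simp: scaleR_nonneg_nonneg)
      then have "J (of_nat n *\<^sub>R f) + J f \<le> inf u z + pprt (u - z)" using f(2) by (rule add_mono)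
      then show ?case by (simp add: inf_add_pprt_diff algebra_simps J_add)
    qed (simp add: J_0 assms)
    then have "J f \<le> 0" by (intro dedekind_complete_archimedean[OF J_dedekind]) (simp add: J_scale)
    then show False using f(1) J_le_iff[of f 0] by (simp add: J_0)
  qed
qed auto

text \<open>The reflection \<open>f \<mapsto> e - f\<close> turns minorants of
  \<open>J e - w\<close> into majorants of \<open>w\<close>.\<close>

lemma isGlb_majorants:
  assumes "0 \<le> w" "w \<le> J e" shows "isGlb UNIV (J ` {q. w \<le> J q}) w"
proof (unfold isGlb_UNIV_iff, intro conjI allI impI)
  fix z assume z: "\<forall>a\<in>J ` {q. w \<le> J q}. z \<le> a"
  have lub: "isLub UNIV (J ` {f. 0 \<le> f \<and> J f \<le> J e - w}) (J e - w)"
    using assms by (intro isLub_minorants) simp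
  have "J f \<le> J e - z" if f: "J f \<le> J e - w" for f
  proof -
    have "w \<le> J (e - f)" using f by (simp add: J_diff algebra_simps)
    then have "z \<le> J (e - f)" using z by blast
    then show ?thesis by (simp add: J_diff algebra_simps)
  qed
  then have "J e - w \<le> J e - z" using lub unfolding isLub_UNIV_iff by blast
  then show "z \<le> w" by simp
qed auto

end

section \<open>Monotone completeness\<close>

lemma upward_directed_image:
  assumes "upward_directed D" "\<And>x y. x \<le> y \<Longrightarrow> g x \<le> g y"
  shows "upward_directed (g ` D)"
  using assms unfolding upward_directed_def by (simp; meson)

lemma isLub_scaleR_cancel:
  fixes s :: "'a::vector_lattice"
  assumes s: "isLub UNIV ((\<lambda>x. k *\<^sub>R x) ` A) s" and k: "0 < k"
  shows "isLub UNIV A (inverse k *\<^sub>R s)"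
proof (unfold isLub_UNIV_iff, intro conjI ballI allI impI)
  fix a assume "a \<in> A"
  then have "k *\<^sub>R a \<le> s" using s by (auto simp: isLub_UNIV_iff)
  then have "inverse k *\<^sub>R (k *\<^sub>R a) \<le> inverse k *\<^sub>R s" using k by (intro scaleR_left_mono) auto
  then show "a \<le> inverse k *\<^sub>R s" using k by simp
next
  fix z assume "\<forall>a\<in>A. a \<le> z"
  then have "\<forall>a\<in>(\<lambda>x. k *\<^sub>R x) ` A. a \<le> k *\<^sub>R z" using k by (auto intro: scaleR_left_mono)
  then have "s \<le> k *\<^sub>R z" using s by (auto simp: isLub_UNIV_iff)
  then have "inverse k *\<^sub>R s \<le> inverse k *\<^sub>R (k *\<^sub>R z)" using k by (intro scaleR_left_mono) auto
  then show "inverse k *\<^sub>R s \<le> z" using k by simp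
qed

lemma monotonically_complete_lub:
  fixes A :: "'f::normed_lattice set"
  assumes mc: "monotonically_complete r TYPE('f)" and A: "upward_directed A" "A \<subseteq> {0..}"
    and c: "\<And>a. a \<in> A \<Longrightarrow> norm a \<le> c" "0 < c"
  obtains s where "isLub UNIV A s" "norm s \<le> c * r"
proof -
  let ?D = "(\<lambda>x. inverse c *\<^sub>R x) ` A"
  have "upward_directed ?D" using A(1) c(2) by (intro upward_directed_image) (auto intro: scaleR_left_mono)
  moreover have "?D \<subseteq> cball 0 1 \<inter> {0..}"
    using A(2) c by (auto simp: scaleR_nonneg_nonneg field_simps)
  ultimately obtain s where s: "isLub UNIV ?D s" "norm s \<le> r"
    using mc unfolding monotonically_complete_def by blast
  have "isLub UNIV A (c *\<^sub>R s)" using isLub_scaleR_cancel[OF s(1)] c(2) by simp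
  moreover have "norm (c *\<^sub>R s) \<le> c * r" using s(2) c(2) by simp
  ultimately show thesis by (rule that)
qed

text \<open>The sums of consecutive terms from index \<open>n\<close> on are directed with norms at
  most \<open>2 * (1/2)^n\<close>, so they have a supremum \<open>t n\<close> of norm at most
  \<open>2 * (1/2)^n * r\<close>. What a partial sum misses of \<open>t 0\<close> is at most
  \<open>t n\<close>, so the series converges in norm to \<open>t 0\<close>.\<close>

lemma monotonically_complete_positive_series:
  fixes z :: "nat \<Rightarrow> 'f::normed_lattice"
  assumes mc: "monotonically_complete r TYPE('f)" 
    and z: "\<And>n. 0 \<le> z n" "\<And>n. norm (z n) \<le> (1/2)^n"
  shows "summable z"
proof -
  define A where "A n = {sum z {n..<m} | m. n \<le> m}" for n
  have norm_sum: "norm (sum z {n..<m}) \<le> 2 * (1/2)^n" if "n \<le> m" for n m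
  proof -
    have "norm (sum z {n..<m}) \<le> (\<Sum>i=n..<m. (1/2)^i)" using z(2) by (rule sum_norm_le)
    also have "\<dots> = 2 * (1/2)^n - 2 * (1/2::real)^m"
      using that by (induction m rule: dec_induct) auto
    finally show ?thesis by (simp add: order_trans)
  qed
  have "\<exists>t. isLub UNIV (A n) t \<and> norm t \<le> 2 * (1/2)^n * r" for n
  proof -
    have mono: "sum z {n..<m} \<le> sum z {n..<m'}" if "m \<le> m'" for m m'
      using that z(1) by (intro sum_mono2) auto
    have "upward_directed (A n)" unfolding upward_directed_def
    proof (intro conjI ballI)
      fix a b assume "a \<in> A n" "b \<in> A n"
      then obtain m m' where m: "a = sum z {n..<m}" "n \<le> m" "b = sum z {n..<m'}" "n \<le> m'"
        by (auto simp: A_def)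
      then have "sum z {n..<max m m'} \<in> A n" by (auto simp: A_def le_max_iff_disj)
      moreover have "a \<le> sum z {n..<max m m'}" "b \<le> sum z {n..<max m m'}"
        unfolding m by (auto intro!: mono)
      ultimately show "\<exists>c\<in>A n. a \<le> c \<and> b \<le> c" by blast
    qed (auto simp: A_def)
    moreover have "A n \<subseteq> {0..}" using z(1) by (auto simp: A_def intro: sum_nonneg)
    ultimately show ?thesis using norm_sum
      by (elim monotonically_complete_lub[OF mc, where c = "2 * (1/2)^n"]) (auto simp: A_def)
  qed
  then obtain t where t: "\<And>n. isLub UNIV (A n) (t n)" "\<And>n. norm (t n) \<le> 2 * (1/2)^n * r" by metis
  have tge: "sum z {n..<m} \<le> t n" if "n \<le> m" for n m 
    using t(1)[of n] that unfolding isLub_UNIV_iff A_def by blast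
  have "norm (t 0 - sum z {..<n}) \<le> norm (t n)" for n
  proof (rule norm_mono_pos)
    show "0 \<le> t 0 - sum z {..<n}" using tge[of 0 n] by (simp add: lessThan_atLeast0)
    have "sum z {0..<m} \<le> sum z {0..<n} + t n" for m
    proof (cases "n \<le> m")
      case True
      then show ?thesis using tge[OF True] sum.atLeastLessThan_concat[of 0 n m z, symmetric] by simp
    next
      case False
      then have "sum z {0..<m} \<le> sum z {0..<n}" using z(1) by (intro sum_mono2) auto
      moreover have "0 \<le> t n" using tge[of n n] by simp
      ultimately show ?thesis by (simp add: add_increasing2)
    qed
    then have "t 0 \<le> sum z {0..<n} + t n"
      using t(1)[of 0] unfolding isLub_UNIV_iff A_def by blast
    then show "t 0 - sum z {..<n} \<le> t n" by (simp add: lessThan_atLeast0 algebra_simps)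
  qed
  then have *: "norm (sum z {..<n} - t 0) \<le> 2 * (1/2)^n * r" for n
    using t(2) by (metis norm_minus_commute order_trans)
  have "(\<lambda>n. 2 * (1/2)^n * r) \<longlonglongrightarrow> 0"
    by (rule tendsto_eq_rhs, (rule tendsto_intros LIMSEQ_power_zero | simp)+)
  then have "(\<lambda>n. sum z {..<n} - t 0) \<longlonglongrightarrow> 0"
    by (rule Lim_null_comparison[rotated]) (simp add: *)
  then show ?thesis by (auto simp: summable_def sums_def LIM_zero_iff)
qed

text \<open>A subsequence with rapidly decreasing increments converges, because the positive and the
  negative parts of the increments form summable positive series. A Cauchy sequence converges
  together with its subsequence.\<close>

lemma monotonically_complete_imp_complete:
  assumes mc: "monotonically_complete r TYPE('f::normed_lattice)"
  shows "complete (UNIV :: 'f set)"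
proof (unfold complete_def, intro allI impI, elim conjE)
  fix X :: "nat \<Rightarrow> 'f" assume X: "Cauchy X"
  have "\<exists>M. \<forall>i\<ge>M. \<forall>j\<ge>M. norm (X i - X j) < (1/2)^n" for n
    using CauchyD[OF X, of "(1/2)^n"] by simp
  then obtain M where M: "\<And>n i j. M n \<le> i \<Longrightarrow> M n \<le> j \<Longrightarrow> norm (X i - X j) < (1/2)^n" by metis
  \<comment> \<open>Summing the thresholds puts both \<open>k n\<close> and \<open>k (Suc n)\<close>
    beyond \<open>M n\<close>, whether or not \<open>M\<close> is monotone.\<close>
  define k where "k n = (\<Sum>i\<le>n. M i)" for n
  have kM: "M n \<le> k n" "M n \<le> k (Suc n)" for n 
    unfolding k_def by (rule member_le_sum; simp)+
  define d where "d n = X (k (Suc n)) - X (k n)" for n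
  have dn: "norm (d n) \<le> (1/2)^n" for n
    using M[OF kM(2) kM(1), of n] by (simp add: d_def)
  have "norm (pprt x) \<le> norm x" for x :: 'f
    by (intro norm_solid) (simp add: pprt_def abs_ge_self)
  then have le: "norm (pprt (d n)) \<le> (1/2)^n" "norm (pprt (- d n)) \<le> (1/2)^n" for n
    using dn[of n] by (metis order_trans norm_minus_cancel)+
  have "summable (\<lambda>n. pprt (d n) - pprt (- d n))"
    by (intro summable_diff monotonically_complete_positive_series[OF mc] le) auto
  moreover have "pprt (d n) - pprt (- d n) = d n" for n
    using prts[of "d n"] by (simp add: pprt_neg)
  ultimately have "convergent (\<lambda>n. \<Sum>i<n. d i)" by (simp add: summable_iff_convergent)
  moreover have "(\<Sum>i<n. d i) = X (k n) - X (k 0)" for n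
    unfolding d_def by (rule sum_lessThan_telescope)
  ultimately have "convergent (\<lambda>n. X (k n) - X (k 0))" by simp
  then obtain L where "(\<lambda>n. X (k n) - X (k 0)) \<longlonglongrightarrow> L" by (auto simp: convergent_def)
  then have "(\<lambda>n. X (k n) - X (k 0) + X (k 0)) \<longlonglongrightarrow> L + X (k 0)" by (intro tendsto_intros)
  then have L: "(\<lambda>n. X (k n)) \<longlonglongrightarrow> L + X (k 0)" by simp
  define l where "l = L + X (k 0)"
  have "X \<longlonglongrightarrow> l"
  proof (rule LIMSEQ_I)
    fix e :: real assume e: "0 < e"
    obtain n0 where n0: "\<And>n. n0 \<le> n \<Longrightarrow> norm (X (k n) - l) < e/2"
      using LIMSEQ_D[OF L, of "e/2"] e by (auto simp: l_def)
    obtain m where m: "(1/2)^m < e/2" using real_arch_pow_inv[of "e/2" "1/2"] e by auto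
    define n where "n = max n0 m"
    have "(1/2::real)^n \<le> (1/2)^m" by (intro power_decreasing) (auto simp: n_def)
    then have n: "(1/2::real)^n < e/2" using m by (rule order_le_less_trans)
    have "norm (X i - l) < e" if "M n \<le> i" for i
    proof -
      have "norm (X i - l) \<le> norm (X i - X (k n)) + norm (X (k n) - l)"
        using norm_triangle_ineq[of "X i - X (k n)" "X (k n) - l"] by simp
      also have "\<dots> < e/2 + e/2"
        using M[OF that kM(1)[of n]] n n0[of n] by (intro add_strict_mono) (auto simp: n_def)
      finally show ?thesis by simp
    qed
    then show "\<exists>no. \<forall>n\<ge>no. norm (X n - l) < e" by blast
  qed
  then show "\<exists>l\<in>UNIV. X \<longlonglongrightarrow> l" by blast
qed

section \<open>Finite suprema of disjoint sets\<close>

lemma upward_directed_finite_sups: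
  assumes "D \<noteq> {}" shows "upward_directed (finite_sups D)"
  unfolding upward_directed_def
proof (intro conjI ballI)
  show "finite_sups D \<noteq> {}" using assms by (auto simp: finite_sups_def)
  fix a b assume "a \<in> finite_sups D" "b \<in> finite_sups D"
  then obtain A B where AB: "a = Sup_fin A" "A \<subseteq> D" "finite A" "A \<noteq> {}" "b = Sup_fin B" "B \<subseteq> D" "finite B" "B \<noteq> {}"
    by (auto simp: finite_sups_def)
  then have "Sup_fin (A \<union> B) \<in> finite_sups D" by (auto simp: finite_sups_def)
  moreover have "a \<le> Sup_fin (A \<union> B)" "b \<le> Sup_fin (A \<union> B)"
    using AB by (simp_all add: Sup_fin.union)
  ultimately show "\<exists>c\<in>finite_sups D. a \<le> c \<and> b \<le> c" by blast
qed

lemma isLub_finite_sups: "isLub UNIV (finite_sups D) s \<longleftrightarrow> isLub UNIV D s"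
proof -
  have "(\<forall>a\<in>finite_sups D. a \<le> z) \<longleftrightarrow> (\<forall>a\<in>D. a \<le> z)" for z
  proof (intro iffI ballI)
    fix a assume *: "\<forall>a\<in>finite_sups D. a \<le> z" "a \<in> D"
    then have "Sup_fin {a} \<in> finite_sups D" unfolding finite_sups_def by blast
    then show "a \<le> z" using * by auto
  next
    fix a assume *: "\<forall>a\<in>D. a \<le> z" "a \<in> finite_sups D"
    then show "a \<le> z" by (auto simp: finite_sups_def intro!: Sup_fin.boundedI)
  qed
  then show ?thesis by (simp add: isLub_UNIV_iff)
qed

text \<open>The finite suprema of \<open>D\<close> form a directed set with the same upper bounds as
  \<open>D\<close>, so monotone completeness applies to them.\<close>

lemma monotonically_complete_disjoint_lub:
  fixes D :: "'f::normed_lattice set"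
  assumes mc: "monotonically_complete r TYPE('f)"
    and D: "D \<noteq> {}" "disjoint_positive D" "finite_sups D \<subseteq> cball 0 1"
  shows "\<exists>s. isLub UNIV D s \<and> norm s \<le> r"
proof -
  have "finite_sups D \<subseteq> {0..}"
  proof
    fix x assume "x \<in> finite_sups D"
    then obtain B where B: "x = Sup_fin B" "finite B" "B \<subseteq> D" "B \<noteq> {}" by (auto simp: finite_sups_def)
    then obtain b where "b \<in> B" by blast
    then have "0 \<le> b" "b \<le> x" using B D(2) by (auto simp: disjoint_positive_def intro: Sup_fin.coboundedI)
    then show "x \<in> {0..}" by simp
  qed
  then show ?thesis
    using mc D upward_directed_finite_sups[OF D(1)] 
    unfolding monotonically_complete_def isLub_finite_sups[symmetric, of D] by blast
qed

section \<open>Reduction to dominable sets and recognition of elements of the range\<close>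

locale normed_universal_completion = universal_completion_embedding J
  for J :: "'f::normed_lattice \<Rightarrow> 'u::vector_lattice"
begin

lemma dominable_lub_imp_monotonically_complete:
  assumes ii: "\<And>D :: 'f set. upward_directed D \<Longrightarrow> dominable J D \<Longrightarrow> D \<subseteq> cball 0 1 \<inter> {0..} \<Longrightarrow>
              \<exists>s. isLub UNIV D s \<and> norm s \<le> r"
  shows "monotonically_complete r TYPE('f)"
  unfolding monotonically_complete_def
proof (intro allI impI, elim conjE)
  fix D :: "'f set" assume D: "upward_directed D" "D \<subseteq> cball 0 1 \<inter> {0..}"
  have bb: "bdd_above (J ` D)"
  proof (rule ccontr)
    assume nb: "\<not> bdd_above (J ` D)"
    have "J ` D \<subseteq> {0..}" using D(2) by (auto simp: J_ge_0_iff)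
    from unbounded_subset[OF _ this nb] uc obtain u where u: "u > 0"
      "\<And>n::nat. isLub UNIV ((\<lambda>d. inf d (of_nat n *\<^sub>R u)) ` J ` D) (of_nat n *\<^sub>R u)"
      by (auto simp: universal_completion_def)
    obtain f where f: "0 < f" "J f \<le> u" using J_dense[OF u(1)] .
    have "of_nat n * norm f \<le> r" for n :: nat
    proof -
      define e where "e = of_nat n *\<^sub>R f"
      have e: "0 \<le> e" "J e \<le> of_nat n *\<^sub>R u"
        using f by (auto simp: e_def J_scale scaleR_nonneg_nonneg intro: scaleR_left_mono)
      let ?E = "(\<lambda>d. inf d e) ` D"
      have lub: "isLub UNIV ?E e"
      proof (rule isLub_of_image, unfold isLub_UNIV_iff, intro conjI allI impI)
        show "\<forall>a\<in>J ` ?E. a \<le> J e" by (auto simp: J_le_iff)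
        fix z assume z: "\<forall>a\<in>J ` ?E. a \<le> z"
        \<comment> \<open>Since \<open>J e\<close> lies below the \<open>n\<close>-th multiple of
          \<open>u\<close>, truncating once more at \<open>J e\<close> turns the supremum known for
          \<open>u\<close> into \<open>J e\<close>.\<close>
        have "inf (of_nat n *\<^sub>R u) (J e) \<le> z"
        proof (rule isLub_inf_le[OF u(2)])
          fix a assume "a \<in> (\<lambda>d. inf d (of_nat n *\<^sub>R u)) ` J ` D"
          then obtain d where d: "d \<in> D" "a = inf (J d) (of_nat n *\<^sub>R u)" by auto
          have "inf a (J e) \<le> J (inf d e)" by (simp add: d J_inf le_infI1)
          also have "\<dots> \<le> z" using z d by auto
          finally show "inf a (J e) \<le> z" .
        qed
        then show "J e \<le> z" using e(2) by (simp add: inf_absorb2)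
      qed
      have "upward_directed ?E" using D(1) by (intro upward_directed_image inf_mono) auto
      moreover have "dominable J ?E" unfolding dominable_def bdd_below_def bdd_above_def
      proof
        show "\<exists>m. \<forall>x\<in>J ` ?E. m \<le> x" using D(2) e(1) by (intro exI[of _ 0]) (auto simp: J_ge_0_iff)
        show "\<exists>m. \<forall>x\<in>J ` ?E. x \<le> m" by (intro exI[of _ "J e"]) (auto simp: J_le_iff)
      qed
      moreover have "?E \<subseteq> cball 0 1 \<inter> {0..}"
      proof
        fix x assume "x \<in> ?E"
        then obtain d where d: "d \<in> D" "x = inf d e" by auto
        then have "0 \<le> x" using D(2) e(1) by auto
        moreover have "norm x \<le> norm d" using \<open>0 \<le> x\<close> d by (intro norm_mono_pos) auto
        ultimately show "x \<in> cball 0 1 \<inter> {0..}" using D(2) d by auto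
      qed
      ultimately obtain s where s: "isLub UNIV ?E s" "norm s \<le> r" using ii by blast
      have "s = e" using isLub_UNIV_unique[OF s(1) lub] .
      then show ?thesis using s(2) by (simp add: e_def)
    qed
    moreover have "0 < norm f" using f(1) by auto
    ultimately show False using reals_Archimedean3[of "norm f"] by (meson not_less)
  qed
  have "bdd_below (J ` D)" unfolding bdd_below_def
    using D(2) by (intro exI[of _ 0]) (auto simp: J_ge_0_iff)
  then show "\<exists>s. isLub UNIV D s \<and> norm s \<le> r" using ii[OF D(1) _ D(2)] bb by (simp add: dominable_def)
qed

text \<open>The minorants of \<open>u\<close> from \<open>'f\<close> are directed and norm bounded,
  so they have a supremum in \<open>'f\<close>. Its image and \<open>u\<close> are suprema of the
  same set.\<close>

lemma dominated_in_range:
  assumes mc: "monotonically_complete r TYPE('f)"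
    and u: "0 \<le> u" and c: "\<And>f. 0 \<le> f \<Longrightarrow> J f \<le> u \<Longrightarrow> norm f \<le> c" "0 < c"
  obtains s where "J s = u" "norm s \<le> c * r"
proof -
  let ?A = "{f. 0 \<le> f \<and> J f \<le> u}"
  have "upward_directed ?A" unfolding upward_directed_def
  proof (intro conjI ballI)
    show "?A \<noteq> {}" using u by (auto simp: J_0 intro!: exI[of _ 0])
    fix a b assume "a \<in> ?A" "b \<in> ?A"
    then show "\<exists>c\<in>?A. a \<le> c \<and> b \<le> c" by (intro bexI[of _ "sup a b"]) (auto simp: J_sup le_supI1)
  qed
  then obtain s where s: "isLub UNIV ?A s" "norm s \<le> c * r"
    using c by (elim monotonically_complete_lub[OF mc, of ?A c]) auto
  have "J s = u" using isLub_UNIV_unique[OF isLub_image[OF s(1)] isLub_minorants[OF u]] .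
  then show thesis using that s(2) by blast
qed

end

section \<open>Order convergence and unbounded order convergence\<close>

text \<open>Translation and positive part carry the supremum of a nonempty set to that of its image;
  \<open>isLub_inf_le\<close> then handles the truncation.\<close>

lemma isLub_inf_pprt_le:
  fixes s :: "'a::vector_lattice"
  assumes s: "isLub UNIV A s" and ne: "A \<noteq> {}" and q: "\<And>a. a \<in> A \<Longrightarrow> inf (pprt (a - x)) e \<le> q"
  shows "inf (pprt (s - x)) e \<le> q"
proof (rule isLub_inf_le)
  show "isLub UNIV ((\<lambda>a. pprt (a - x)) ` A) (pprt (s - x))"
  proof (unfold isLub_UNIV_iff, intro conjI allI impI)
    show "\<forall>a\<in>(\<lambda>a. pprt (a - x)) ` A. a \<le> pprt (s - x)"
      using s by (auto simp: isLub_UNIV_iff intro!: pprt_mono)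
    fix z assume z: "\<forall>a\<in>(\<lambda>a. pprt (a - x)) ` A. a \<le> z"
    then have "a \<le> z + x" if "a \<in> A" for a
      using that by (auto simp: pprt_def algebra_simps)
    then have "s \<le> z + x" using s by (auto simp: isLub_UNIV_iff)
    moreover have "0 \<le> z" using z ne by (auto simp: pprt_def)
    ultimately show "pprt (s - x) \<le> z" by (simp add: pprt_def algebra_simps)
  qed
qed (use q in auto)

lemma inf_abs_le:
  fixes y :: "'a::vector_lattice"
  assumes "inf (pprt y) e \<le> q" "inf (pprt (- y)) e \<le> q"
  shows "inf \<bar>y\<bar> e \<le> q"
proof (rule isLub_inf_le)
  show "isLub UNIV {pprt y, pprt (- y)} \<bar>y\<bar>"
    by (auto simp: isLub_UNIV_iff pprt_def abs_ge_self abs_ge_minus_self intro: abs_leI)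
qed (use assms in auto)

lemma directed_indexD:
  assumes "directed_index P le"
  shows "p \<in> P \<Longrightarrow> le p p" "P \<noteq> {}"
    "p \<in> P \<Longrightarrow> q \<in> P \<Longrightarrow> le p q \<Longrightarrow> s \<in> P \<Longrightarrow> le q s \<Longrightarrow> le p s"
    "p \<in> P \<Longrightarrow> q \<in> P \<Longrightarrow> \<exists>s\<in>P. le p s \<and> le q s"
  using assms unfolding directed_index_def by (auto dest: reflp_onD transp_onD)

lemma decreases_to_zeroD:
  assumes "decreases_to_zero Q"
  shows "q \<in> Q \<Longrightarrow> 0 \<le> q" "(\<And>q. q \<in> Q \<Longrightarrow> z \<le> q) \<Longrightarrow> z \<le> 0"
  using assms by (auto simp: decreases_to_zero_def isGlb_UNIV_iff)

lemma decreases_to_zero_add: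
  assumes A: "decreases_to_zero A" and B: "decreases_to_zero B"
  shows "decreases_to_zero {a + b | a b. a \<in> A \<and> b \<in> B}"
  unfolding decreases_to_zero_def
proof (intro conjI ballI)
  show "{a + b | a b. a \<in> A \<and> b \<in> B} \<noteq> {}" using assms by (auto simp: decreases_to_zero_def)
  fix x y assume "x \<in> {a + b | a b. a \<in> A \<and> b \<in> B}" "y \<in> {a + b | a b. a \<in> A \<and> b \<in> B}"
  then obtain a b a' b' where x: "x = a + b" "y = a' + b'" "a \<in> A" "b \<in> B" "a' \<in> A" "b' \<in> B" by auto
  obtain c where c: "c \<in> A" "c \<le> a" "c \<le> a'" using x A unfolding decreases_to_zero_def by blast
  obtain d where d: "d \<in> B" "d \<le> b" "d \<le> b'" using x B unfolding decreases_to_zero_def by blast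
  have "c + d \<in> {a + b | a b. a \<in> A \<and> b \<in> B}" using c(1) d(1) by blast
  moreover have "c + d \<le> x" "c + d \<le> y" unfolding x(1,2) using c d by (auto intro: add_mono)
  ultimately show "\<exists>c\<in>{a + b | a b. a \<in> A \<and> b \<in> B}. c \<le> x \<and> c \<le> y" by blast
next
  show "isGlb UNIV {a + b | a b. a \<in> A \<and> b \<in> B} 0"
  proof (unfold isGlb_UNIV_iff, intro conjI allI impI)
    show "\<forall>a\<in>{a + b | a b. a \<in> A \<and> b \<in> B}. 0 \<le> a"
      using decreases_to_zeroD(1)[OF A] decreases_to_zeroD(1)[OF B] by auto
    fix z assume z: "\<forall>x\<in>{a + b | a b. a \<in> A \<and> b \<in> B}. z \<le> x"
    have "z - a \<le> 0" if a: "a \<in> A" for a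
    proof (rule decreases_to_zeroD(2)[OF B])
      fix b assume "b \<in> B"
      then have "z \<le> a + b" using z a by auto
      then show "z - a \<le> b" by (simp add: algebra_simps)
    qed
    then show "z \<le> 0" by (intro decreases_to_zeroD(2)[OF A]) simp
  qed
qed

section \<open>Unbounded order convergence through truncated estimates\<close>

lemma order_converges_truncated_iff:
  fixes y :: "'i \<Rightarrow> 'a::vector_lattice"
  assumes "0 \<le> e"
  shows "order_converges P le (\<lambda>p. inf \<bar>y p\<bar> e) 0 \<longleftrightarrow>
    (\<exists>Q. decreases_to_zero Q \<and> (\<forall>q\<in>Q. \<exists>p\<^sub>q\<in>P. \<forall>p\<in>P. le p\<^sub>q p \<longrightarrow> inf \<bar>y p\<bar> e \<le> q))"
proof -
  have "\<bar>inf \<bar>y p\<bar> e - 0\<bar> = inf \<bar>y p\<bar> e" for p using assms by simp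
  then show ?thesis unfolding order_converges_def by simp
qed

lemma uo_converges_iff:
  fixes x :: "'i \<Rightarrow> 'a::vector_lattice"
  shows "uo_converges P le x l \<longleftrightarrow> (\<forall>e\<ge>0. \<exists>Q. decreases_to_zero Q \<and>
    (\<forall>q\<in>Q. \<exists>p\<^sub>q\<in>P. \<forall>p\<in>P. le p\<^sub>q p \<longrightarrow> inf \<bar>x p - l\<bar> e \<le> q))"
  by (simp add: uo_converges_def order_converges_truncated_iff)

text \<open>A common upper bound merges the two thresholds of the product index into one.\<close>

lemma uo_Cauchy_iff:
  fixes x :: "'i \<Rightarrow> 'a::vector_lattice"
  assumes P: "directed_index P le"
  shows "uo_Cauchy P le x \<longleftrightarrow> (\<forall>e\<ge>0. \<exists>Q. decreases_to_zero Q \<and>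
    (\<forall>q\<in>Q. \<exists>p\<^sub>q\<in>P. \<forall>a\<in>P. \<forall>b\<in>P. le p\<^sub>q a \<longrightarrow> le p\<^sub>q b \<longrightarrow> inf \<bar>x a - x b\<bar> e \<le> q))"
proof -
  have "(\<exists>s\<in>P \<times> P. \<forall>p\<in>P \<times> P. (case s of (p, q) \<Rightarrow> \<lambda>(p', q'). le p p' \<and> le q q') p \<longrightarrow> 
          inf \<bar>(case p of (p, q) \<Rightarrow> x p - x q) - 0\<bar> e \<le> q) \<longleftrightarrow>
        (\<exists>s\<in>P. \<forall>a\<in>P. \<forall>b\<in>P. le s a \<longrightarrow> le s b \<longrightarrow> inf \<bar>x a - x b\<bar> e \<le> q)" (is "?L = ?R") for e q
  proof
    assume ?L
    then obtain p1 p2 where p: "p1 \<in> P" "p2 \<in> P" 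
      "\<And>a b. a \<in> P \<Longrightarrow> b \<in> P \<Longrightarrow> le p1 a \<Longrightarrow> le p2 b \<Longrightarrow> inf \<bar>x a - x b\<bar> e \<le> q" by auto
    obtain s where s: "s \<in> P" "le p1 s" "le p2 s" using directed_indexD(4)[OF P p(1,2)] by blast
    then have "\<forall>a\<in>P. \<forall>b\<in>P. le s a \<longrightarrow> le s b \<longrightarrow> inf \<bar>x a - x b\<bar> e \<le> q"
      using p directed_indexD(3)[OF P] by meson
    then show ?R using s(1) by blast
  next
    assume ?R
    then obtain s where "s \<in> P" "\<forall>a\<in>P. \<forall>b\<in>P. le s a \<longrightarrow> le s b \<longrightarrow> inf \<bar>x a - x b\<bar> e \<le> q" by blast
    then show ?L by (intro bexI[of _ "(s, s)"]) auto
  qed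
  then show ?thesis unfolding uo_Cauchy_def uo_converges_iff by simp
qed

lemma uo_Cauchy_mono:
  fixes x y :: "'i \<Rightarrow> 'a::vector_lattice"
  assumes P: "directed_index P le" and x: "uo_Cauchy P le x" 
    and le: "\<And>p q. \<bar>y p - y q\<bar> \<le> \<bar>x p - x q\<bar>"
  shows "uo_Cauchy P le y"
proof -
  have "inf \<bar>y a - y b\<bar> e \<le> q" if "inf \<bar>x a - x b\<bar> e \<le> q" for a b e q
    using le[of a b] that by (meson inf_mono order_refl order_trans)
  then show ?thesis using x unfolding uo_Cauchy_iff[OF P] by meson
qed

lemma uo_converges_diff:
  fixes x y :: "'i \<Rightarrow> 'a::vector_lattice"
  assumes P: "directed_index P le" and x: "uo_converges P le x a" and y: "uo_converges P le y b"
  shows "uo_converges P le (\<lambda>p. x p - y p) (a - b)"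
  unfolding uo_converges_iff
proof (intro allI impI)
  fix e :: 'a assume e: "0 \<le> e"
  obtain A where A: "decreases_to_zero A" "\<And>q. q \<in> A \<Longrightarrow> \<exists>s\<in>P. \<forall>p\<in>P. le s p \<longrightarrow> inf \<bar>x p - a\<bar> e \<le> q"
    using x e unfolding uo_converges_iff by blast
  obtain B where B: "decreases_to_zero B" "\<And>q. q \<in> B \<Longrightarrow> \<exists>s\<in>P. \<forall>p\<in>P. le s p \<longrightarrow> inf \<bar>y p - b\<bar> e \<le> q"
    using y e unfolding uo_converges_iff by blast
  let ?Q = "{a + b | a b. a \<in> A \<and> b \<in> B}"
  have "\<exists>s\<in>P. \<forall>p\<in>P. le s p \<longrightarrow> inf \<bar>x p - y p - (a - b)\<bar> e \<le> q" if q: "q \<in> ?Q" for q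
  proof -
    obtain q1 q2 where q: "q = q1 + q2" "q1 \<in> A" "q2 \<in> B" using q by auto
    obtain s1 s2 where s: "s1 \<in> P" "\<And>p. p \<in> P \<Longrightarrow> le s1 p \<Longrightarrow> inf \<bar>x p - a\<bar> e \<le> q1"
      "s2 \<in> P" "\<And>p. p \<in> P \<Longrightarrow> le s2 p \<Longrightarrow> inf \<bar>y p - b\<bar> e \<le> q2"
      using A(2)[OF q(2)] B(2)[OF q(3)] by blast
    obtain s where t: "s \<in> P" "le s1 s" "le s2 s" using directed_indexD(4)[OF P s(1,3)] by blast
    have "inf \<bar>x p - y p - (a - b)\<bar> e \<le> q" if p: "p \<in> P" "le s p" for p
    proof -
      have eq: "x p - y p - (a - b) = (x p - a) - (y p - b)" by (simp add: algebra_simps)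
      have "\<bar>x p - y p - (a - b)\<bar> \<le> \<bar>x p - a\<bar> + \<bar>y p - b\<bar>" unfolding eq by (rule abs_triangle_ineq4)
      then have "inf \<bar>x p - y p - (a - b)\<bar> e \<le> inf (\<bar>x p - a\<bar> + \<bar>y p - b\<bar>) e" by (intro inf_mono) auto
      also have "\<dots> \<le> inf \<bar>x p - a\<bar> e + inf \<bar>y p - b\<bar> e" using e by (intro inf_add_le) auto
      also have "\<dots> \<le> q1 + q2" 
        using s(2)[OF p(1)] s(4)[OF p(1)] directed_indexD(3)[OF P _ t(1) _ p(1) p(2)] s(1,3) t(2,3)
        by (intro add_mono) auto
      finally show ?thesis by (simp add: q)
    qed
    then show ?thesis using t(1) by blast
  qed
  then show "\<exists>Q. decreases_to_zero Q \<and> (\<forall>q\<in>Q. \<exists>p\<^sub>q\<in>P. \<forall>p\<in>P. le p\<^sub>q p \<longrightarrow> inf \<bar>x p - y p - (a - b)\<bar> e \<le> q)"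
    using decreases_to_zero_add[OF A(1) B(1)] by blast
qed

text \<open>Truncating at \<open>pprt a\<close> cuts off nothing of \<open>a\<close>, so
  \<open>a\<close> lies below every element of a set decreasing to \<open>0\<close>. This identifies
  the uo limit of an increasing net as its supremum.\<close>

lemma uo_converges_le_0:
  fixes a l :: "'a::vector_lattice"
  assumes P: "directed_index P le" and x: "uo_converges P le x l"
    and p0: "p0 \<in> P" "\<And>p. p \<in> P \<Longrightarrow> le p0 p \<Longrightarrow> a \<le> \<bar>x p - l\<bar>"
  shows "a \<le> 0"
proof -
  obtain Q where Q: "decreases_to_zero Q" 
    "\<And>q. q \<in> Q \<Longrightarrow> \<exists>s\<in>P. \<forall>p\<in>P. le s p \<longrightarrow> inf \<bar>x p - l\<bar> (pprt a) \<le> q"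
    using x zero_le_pprt[of a] unfolding uo_converges_iff by blast
  show ?thesis
  proof (rule decreases_to_zeroD(2)[OF Q(1)])
    fix q assume "q \<in> Q"
    then obtain s where s: "s \<in> P" "\<And>p. p \<in> P \<Longrightarrow> le s p \<Longrightarrow> inf \<bar>x p - l\<bar> (pprt a) \<le> q" using Q(2) by blast
    obtain p where p: "p \<in> P" "le p0 p" "le s p" using directed_indexD(4)[OF P p0(1) s(1)] by blast
    have "a \<le> inf \<bar>x p - l\<bar> (pprt a)" using p0(2)[OF p(1,2)] by (simp add: pprt_def)
    also have "\<dots> \<le> q" by (rule s(2)[OF p(1,3)])
    finally show "a \<le> q" .
  qed
qed

section \<open>Order adherence and uo completeness\<close>

context normed_universal_completion
begin

lemma order_adherence_subset:
  assumes mc: "monotonically_complete r TYPE('f)" and r: "1 \<le> r"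
  shows "order_adherence TYPE('i) (J ` cball 0 1) \<subseteq> J ` cball 0 r"
proof
  fix l assume "l \<in> order_adherence TYPE('i) (J ` cball 0 1)"
  then obtain P :: "'i set" and le x where P: "directed_index P le" "x ` P \<subseteq> J ` cball 0 1" 
    and ox: "order_converges P le x l" by (auto simp: order_adherence_def)
  then obtain Q where Q: "decreases_to_zero Q" "\<forall>q\<in>Q. \<exists>s\<in>P. \<forall>p\<in>P. le s p \<longrightarrow> \<bar>x p - l\<bar> \<le> q"
    by (auto simp: order_converges_def)
  have approx: "\<exists>y. norm y \<le> 1 \<and> \<bar>J y - l\<bar> \<le> q" if q: "q \<in> Q" for q
  proof -
    obtain s where s: "s \<in> P" "\<bar>x s - l\<bar> \<le> q" using Q(2) q directed_indexD(1)[OF P(1)] by blast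
    moreover obtain y where "x s = J y" "norm y \<le> 1" using P(2) s(1) by fastforce
    ultimately show ?thesis by auto
  qed
  \<comment> \<open>Each \<open>q\<close> in \<open>Q\<close> admits \<open>y\<close> in the unit
    ball with \<open>\<bar>J y - l\<bar> \<le> q\<close>, whence
    \<open>pprt (\<bar>l\<bar> - q) \<le> \<bar>J y\<bar>\<close>. So \<open>D\<close> lies in the
    unit ball, while its image still has supremum \<open>\<bar>l\<bar>\<close>.\<close>
  define D where "D = {f. 0 \<le> f \<and> (\<exists>q\<in>Q. J f \<le> pprt (\<bar>l\<bar> - q))}"
  have "upward_directed D" unfolding upward_directed_def
  proof (intro conjI ballI)
    show "D \<noteq> {}" using Q(1) by (auto simp: D_def decreases_to_zero_def J_0 intro!: exI[of _ 0])
    fix a b assume "a \<in> D" "b \<in> D"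
    then obtain q q' where q: "0 \<le> a" "0 \<le> b" "q \<in> Q" "q' \<in> Q" "J a \<le> pprt (\<bar>l\<bar> - q)" "J b \<le> pprt (\<bar>l\<bar> - q')"
      by (auto simp: D_def)
    obtain c where c: "c \<in> Q" "c \<le> q" "c \<le> q'" using Q(1) q by (auto simp: decreases_to_zero_def)
    have "pprt (\<bar>l\<bar> - q) \<le> pprt (\<bar>l\<bar> - c)" "pprt (\<bar>l\<bar> - q') \<le> pprt (\<bar>l\<bar> - c)"
      using c by (auto intro!: pprt_mono)
    then have "J (sup a b) \<le> pprt (\<bar>l\<bar> - c)" using q by (auto simp: J_sup)
    then have "sup a b \<in> D" using q c by (auto simp: D_def le_supI1)
    then show "\<exists>c\<in>D. a \<le> c \<and> b \<le> c" by (meson sup_ge1 sup_ge2)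
  qed
  moreover have "D \<subseteq> cball 0 1 \<inter> {0..}"
  proof
    fix f assume "f \<in> D"
    then obtain q where f: "0 \<le> f" "q \<in> Q" "J f \<le> pprt (\<bar>l\<bar> - q)" by (auto simp: D_def)
    obtain y where y: "norm y \<le> 1" "\<bar>J y - l\<bar> \<le> q" using approx[OF f(2)] by blast
    have "\<bar>l\<bar> \<le> \<bar>J y - l\<bar> + \<bar>J y\<bar>" 
      using abs_triangle_ineq4[of "J y" "J y - l"] by (simp add: add.commute)
    also have "\<dots> \<le> q + \<bar>J y\<bar>" using y(2) by simp
    finally have "pprt (\<bar>l\<bar> - q) \<le> \<bar>J y\<bar>" by (simp add: pprt_def algebra_simps)
    then have "f \<le> \<bar>y\<bar>" using f(3) by (simp flip: J_le_iff J_abs)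
    then have "norm f \<le> norm y" using norm_mono_pos[OF f(1), of "\<bar>y\<bar>"] by (simp add: norm_abs_eq)
    then show "f \<in> cball 0 1 \<inter> {0..}" using y(1) f(1) by simp
  qed
  ultimately obtain s where s: "isLub UNIV D s" "norm s \<le> r"
    using mc by (auto simp: monotonically_complete_def)
  have "isLub UNIV (J ` D) \<bar>l\<bar>"
  proof (unfold isLub_UNIV_iff, intro conjI allI impI)
    have "pprt (\<bar>l\<bar> - q) \<le> \<bar>l\<bar>" if "q \<in> Q" for q
      using decreases_to_zeroD(1)[OF Q(1) that] by (simp add: pprt_def)
    then show "\<forall>a\<in>J ` D. a \<le> \<bar>l\<bar>" unfolding D_def by (auto intro: order_trans)
    fix z assume z: "\<forall>a\<in>J ` D. a \<le> z"
    have "\<bar>l\<bar> - z \<le> 0"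
    proof (rule decreases_to_zeroD(2)[OF Q(1)])
      fix q assume q: "q \<in> Q"
      have "pprt (\<bar>l\<bar> - q) \<le> z"
        using isLub_minorants[OF zero_le_pprt, of "\<bar>l\<bar> - q"] z q unfolding isLub_UNIV_iff D_def by blast
      then show "\<bar>l\<bar> - z \<le> q" by (simp add: pprt_def algebra_simps)
    qed
    then show "\<bar>l\<bar> \<le> z" by simp
  qed
  then have Js: "J s = \<bar>l\<bar>" using isLub_UNIV_unique[OF isLub_image[OF s(1)]] by blast
  have bound: "norm f \<le> r" if "0 \<le> f" "J f \<le> \<bar>l\<bar>" for f
  proof -
    have "f \<le> s" using that(2) by (simp add: J_le_iff flip: Js)
    then show ?thesis using norm_mono_pos[OF that(1)] s(2) by (meson order_trans)
  qed
  have le: "pprt l \<le> \<bar>l\<bar>" "pprt (- l) \<le> \<bar>l\<bar>" by (auto simp: pprt_def abs_ge_self abs_ge_minus_self)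
  obtain a where a: "J a = pprt l"
    using dominated_in_range[OF mc zero_le_pprt, of l r] bound order_trans[OF _ le(1)] r by force
  obtain b where b: "J b = pprt (- l)"
    using dominated_in_range[OF mc zero_le_pprt, of "- l" r] bound order_trans[OF _ le(2)] r by force
  \<comment> \<open>\<open>dominated_in_range\<close> bounds the norms of \<open>a\<close> and
    \<open>b\<close> only by \<open>r * r\<close>. The bound \<open>r\<close> for
    \<open>a - b\<close> comes from identifying its modulus with \<open>s\<close>.\<close>
  have ab: "J (a - b) = l" using prts[of l] by (simp add: a b J_diff pprt_neg)
  then have "J \<bar>a - b\<bar> = J s" by (simp add: J_abs Js)
  then have "\<bar>a - b\<bar> = s" using J_inj by (simp add: inj_eq)
  then have "norm (a - b) \<le> r" using s(2) norm_abs_eq by metis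
  then show "l \<in> J ` cball 0 r" using ab by (auto intro!: image_eqI[of _ _ "a - b"])
qed

text \<open>A directed set serves as its own index set, placed in the right summand of the index
  type; \<open>projr\<close> is then the net.\<close>

lemma directed_index_Inr:
  assumes "upward_directed D"
  shows "directed_index (Inr ` D) (\<lambda>a b. projr a \<le> projr b)"
  using assms by (auto simp: directed_index_def upward_directed_def intro!: reflp_onI transp_onI)

lemma order_adherence_imp_dominable_lub:
  assumes oa: "order_adherence TYPE('i + 'f) (J ` cball 0 1) \<subseteq> J ` cball 0 r"
    and D: "upward_directed D" "dominable J D" "D \<subseteq> cball 0 1 \<inter> {0..}"
  shows "\<exists>s. isLub UNIV D s \<and> norm s \<le> r"
proof -
  have Dne: "D \<noteq> {}" using D(1) by (simp add: upward_directed_def)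
  then have "J ` D \<noteq> {}" by simp
  then obtain u where u: "isLub UNIV (J ` D) u"
    using D(2) bounded_lub[of "J ` D"] by (auto simp: dominable_def)
  let ?le = "\<lambda>a b :: 'i + 'f. projr a \<le> projr b"
  have "order_converges (Inr ` D) ?le (\<lambda>p. J (projr p)) u"
    unfolding order_converges_def
  proof (intro exI conjI)
    \<comment> \<open>The differences decrease to \<open>0\<close> because the image of
      \<open>D\<close> increases to \<open>u\<close>; the one at \<open>d\<close> controls the net
      beyond \<open>d\<close>.\<close>
    let ?Q = "(\<lambda>d. u - J d) ` D"
    show "decreases_to_zero ?Q" unfolding decreases_to_zero_def
    proof (intro conjI)
      show "\<forall>a\<in>?Q. \<forall>b\<in>?Q. \<exists>c\<in>?Q. c \<le> a \<and> c \<le> b"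
        using D(1) by (simp add: upward_directed_def J_le_iff)
      show "isGlb UNIV ?Q 0"
      proof (unfold isGlb_UNIV_iff, intro conjI allI impI)
        fix z assume "\<forall>a\<in>?Q. z \<le> a"
        then have "\<forall>a\<in>J ` D. a \<le> u - z" by (auto simp: algebra_simps)
        then have "u \<le> u - z" using u by (auto simp: isLub_UNIV_iff)
        then show "z \<le> 0" by simp
      qed (use u in \<open>auto simp: isLub_UNIV_iff\<close>)
    qed (use Dne in auto)
    show "\<forall>q\<in>?Q. \<exists>p\<^sub>q\<in>Inr ` D. \<forall>p\<in>Inr ` D. ?le p\<^sub>q p \<longrightarrow> \<bar>J (projr p) - u\<bar> \<le> q"
    proof
      fix q assume "q \<in> ?Q"
      then obtain d where d: "d \<in> D" "q = u - J d" by auto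
      have "\<bar>J d' - u\<bar> \<le> q" if "d' \<in> D" "d \<le> d'" for d'
      proof -
        have "J d' \<le> u" using u that by (auto simp: isLub_UNIV_iff)
        then show ?thesis using that by (simp add: d J_le_iff abs_minus_commute[of "J d'"])
      qed
      then show "\<exists>p\<^sub>q\<in>Inr ` D. \<forall>p\<in>Inr ` D. ?le p\<^sub>q p \<longrightarrow> \<bar>J (projr p) - u\<bar> \<le> q"
        using d(1) by auto
    qed
  qed
  moreover have "(\<lambda>p. J (projr p)) ` Inr ` D \<subseteq> J ` cball 0 1" using D(3) by auto
  moreover have "directed_index (Inr ` D) ?le" using D(1) by (rule directed_index_Inr)
  ultimately have "u \<in> order_adherence TYPE('i + 'f) (J ` cball 0 1)"
    unfolding order_adherence_def
    by (intro CollectI exI[of _ "Inr ` D"] exI[of _ ?le] exI[of _ "\<lambda>p. J (projr p)"]) simp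
  then obtain s where "u = J s" "norm s \<le> r" using oa by fastforce
  then show ?thesis using isLub_of_image u by blast
qed

lemma uo_complete_imp_dominable_lub:
  assumes v: "\<And>(P :: ('i + 'f) set) le (x :: 'i + 'f \<Rightarrow> 'f). directed_index P le \<Longrightarrow> x ` P \<subseteq> cball 0 1 \<Longrightarrow> uo_Cauchy P le x \<Longrightarrow>
      \<exists>l\<in>cball 0 r. uo_converges P le x l"
    and D: "upward_directed D" "dominable J D" "D \<subseteq> cball 0 1 \<inter> {0..}"
  shows "\<exists>s. isLub UNIV D s \<and> norm s \<le> r"
proof -
  have Dne: "D \<noteq> {}" using D(1) by (simp add: upward_directed_def)
  then have "J ` D \<noteq> {}" by simp
  then obtain u where u: "isLub UNIV (J ` D) u"
    using D(2) bounded_lub[of "J ` D"] by (auto simp: dominable_def)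
  have Du: "J d \<le> u" if "d \<in> D" for d using u that by (auto simp: isLub_UNIV_iff)
  let ?le = "\<lambda>a b :: 'i + 'f. projr a \<le> projr b" and ?P = "Inr ` D :: ('i + 'f) set"
  have di: "directed_index ?P ?le" using D(1) by (rule directed_index_Inr)
  have "uo_Cauchy ?P ?le projr"
    unfolding uo_Cauchy_iff[OF di]
  proof (intro allI impI exI conjI)
    fix e :: 'f assume e: "0 \<le> e"
    \<comment> \<open>The natural control elements \<open>inf (u - J d) (J e)\<close> lie in the
      universal completion and perhaps not in the range of \<open>J\<close>. They are replaced by
      their majorants from \<open>'f\<close>, which have the same infimum by
      \<open>isGlb_majorants\<close>.\<close>
    let ?Q = "{q. \<exists>d\<in>D. inf (u - J d) (J e) \<le> J q}"
    have pos: "0 \<le> inf (u - J d) (J e)" if "d \<in> D" for d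
      using Du[OF that] e by (simp add: J_ge_0_iff)
    show "decreases_to_zero ?Q" unfolding decreases_to_zero_def
    proof (intro conjI ballI)
      show "?Q \<noteq> {}" using Dne by (auto intro!: exI[of _ e])
      fix a b assume "a \<in> ?Q" "b \<in> ?Q"
      then obtain c d where cd: "c \<in> D" "inf (u - J c) (J e) \<le> J a" "d \<in> D" "inf (u - J d) (J e) \<le> J b"
        by blast
      then obtain t where t: "t \<in> D" "c \<le> t" "d \<le> t" using D(1) by (auto simp: upward_directed_def)
      have "inf (u - J t) (J e) \<le> inf (u - J c) (J e)" "inf (u - J t) (J e) \<le> inf (u - J d) (J e)"
        using t by (auto intro!: inf_mono simp: J_le_iff simp del: inf.bounded_iff)
      then have "inf (u - J t) (J e) \<le> J (inf a b)" using cd unfolding J_inf by (meson inf_greatest order_trans)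
      then show "\<exists>c\<in>?Q. c \<le> a \<and> c \<le> b" using t(1) by (intro bexI[of _ "inf a b"]) auto
    next
      show "isGlb UNIV ?Q 0"
      proof (unfold isGlb_UNIV_iff, intro conjI allI impI)
        show "\<forall>a\<in>?Q. 0 \<le> a" using pos J_ge_0_iff order_trans by blast
        fix z assume z: "\<forall>a\<in>?Q. z \<le> a"
        have "J d \<le> u - J z" if d: "d \<in> D" for d
        proof -
          have "J z \<le> inf (u - J d) (J e)"
          proof -
            have "J z \<le> x" if "x \<in> J ` {q. inf (u - J d) (J e) \<le> J q}" for x
              using that z d by (auto simp: J_le_iff)
            then show ?thesis using isGlb_majorants[OF pos[OF d] inf_le2] unfolding isGlb_UNIV_iff by blast
          qed
          then show ?thesis by (simp add: algebra_simps)
        qed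
        then have "u \<le> u - J z" using u by (auto simp: isLub_UNIV_iff)
        then show "z \<le> 0" using J_le_iff[of z 0] by (simp add: J_0)
      qed
    qed
    show "\<forall>q\<in>?Q. \<exists>s\<in>?P. \<forall>a\<in>?P. \<forall>b\<in>?P. ?le s a \<longrightarrow> ?le s b \<longrightarrow> inf \<bar>projr a - projr b\<bar> e \<le> q"
    proof
      fix q assume "q \<in> ?Q"
      then obtain d where d: "d \<in> D" "inf (u - J d) (J e) \<le> J q" by blast
      have "inf \<bar>a - b\<bar> e \<le> q" if ab: "a \<in> D" "b \<in> D" "d \<le> a" "d \<le> b" for a b
      proof -
        have "J a - J b \<le> u - J d" "J b - J a \<le> u - J d"
          using ab Du by (auto intro!: diff_mono simp: J_le_iff)
        then have "\<bar>J a - J b\<bar> \<le> u - J d" by (intro abs_leI) auto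
        then have "inf \<bar>J a - J b\<bar> (J e) \<le> inf (u - J d) (J e)" by (intro inf_mono) auto
        then have "J (inf \<bar>a - b\<bar> e) \<le> J q" using d(2) unfolding J_inf J_abs J_diff by (rule order_trans)
        then show ?thesis by (simp only: J_le_iff)
      qed
      then show "\<exists>s\<in>?P. \<forall>a\<in>?P. \<forall>b\<in>?P. ?le s a \<longrightarrow> ?le s b \<longrightarrow> inf \<bar>projr a - projr b\<bar> e \<le> q"
        using d(1) by auto
    qed
  qed
  moreover have "projr ` ?P \<subseteq> cball 0 1" using D(3) by auto
  ultimately obtain l where l: "norm l \<le> r" "uo_converges ?P ?le projr l" using v[OF di, of projr] by auto
  \<comment> \<open>For \<open>d\<close> in \<open>D\<close> and an upper bound \<open>z\<close>,
    both \<open>d - l\<close> and \<open>l - z\<close> are dominated by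
    \<open>\<bar>d' - l\<bar>\<close> for all \<open>d'\<close> from some index on.\<close>
  have "isLub UNIV D l"
  proof (unfold isLub_UNIV_iff, intro conjI ballI allI impI)
    fix d assume d: "d \<in> D"
    have "d - l \<le> \<bar>d' - l\<bar>" if "d \<le> d'" for d'
      using that abs_ge_self[of "d' - l"] by (meson diff_right_mono order_trans)
    then have "d - l \<le> 0" using d by (intro uo_converges_le_0[OF di l(2), of "Inr d"]) auto
    then show "d \<le> l" by simp
  next
    fix z assume z: "\<forall>a\<in>D. a \<le> z"
    obtain d where d: "d \<in> D" using Dne by auto
    have "l - z \<le> \<bar>d' - l\<bar>" if "d' \<in> D" for d'
      using that z abs_ge_minus_self[of "d' - l"] by (metis diff_left_mono minus_diff_eq order_trans)
    then have "l - z \<le> 0" using d by (intro uo_converges_le_0[OF di l(2), of "Inr d"]) auto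
    then show "l \<le> z" by simp
  qed
  then show ?thesis using l(1) by blast
qed

text \<open>The supremum of the eventual lower bounds is the order limit inferior of the net.\<close>
lemma uo_Cauchy_positive_limit:
  fixes x :: "'i \<Rightarrow> 'f"
  assumes mc: "monotonically_complete r TYPE('f)" 
    and P: "directed_index P le" and x: "\<And>p. 0 \<le> x p" "\<And>p. p \<in> P \<Longrightarrow> norm (x p) \<le> 1"
    and Cauchy: "uo_Cauchy P le x"
    and A_def: "A = {f. 0 \<le> f \<and> (\<exists>s\<in>P. \<forall>p\<in>P. le s p \<longrightarrow> f \<le> x p)}"
  obtains l where "isLub UNIV A l" "uo_converges P le x l" "upward_directed A"
proof -
  have A_dir: "upward_directed A" unfolding upward_directed_def
  proof (intro conjI ballI)
    show "A \<noteq> {}" using x(1) directed_indexD(2)[OF P] by (auto simp: A_def intro!: exI[of _ 0])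
    fix f g assume "f \<in> A" "g \<in> A"
    then obtain s t where st: "s \<in> P" "t \<in> P" "0 \<le> f" "0 \<le> g"
      "\<And>p. p \<in> P \<Longrightarrow> le s p \<Longrightarrow> f \<le> x p" "\<And>p. p \<in> P \<Longrightarrow> le t p \<Longrightarrow> g \<le> x p" by (auto simp: A_def)
    obtain m where m: "m \<in> P" "le s m" "le t m" using directed_indexD(4)[OF P st(1,2)] by blast
    have "sup f g \<le> x p" if "p \<in> P" "le m p" for p
      using st(5,6)[OF that(1)] directed_indexD(3)[OF P _ m(1) _ that] st(1,2) m(2,3) by auto
    then have "sup f g \<in> A" using m(1) st(3) by (auto simp: A_def le_supI1)
    then show "\<exists>c\<in>A. f \<le> c \<and> g \<le> c" by (meson sup_ge1 sup_ge2)
  qed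
  moreover have "A \<subseteq> cball 0 1 \<inter> {0..}"
  proof
    fix f assume "f \<in> A"
    then obtain p where "0 \<le> f" "p \<in> P" "f \<le> x p" using directed_indexD(1)[OF P] by (auto simp: A_def)
    then show "f \<in> cball 0 1 \<inter> {0..}" using x(2)[of p] norm_mono_pos[of f "x p"] by auto
  qed
  ultimately obtain l where l: "isLub UNIV A l" using mc by (auto simp: monotonically_complete_def)
  have "uo_converges P le x l" unfolding uo_converges_iff
  proof (intro allI impI)
    fix e :: 'f assume e: "0 \<le> e"
    obtain Q where Q: "decreases_to_zero Q"
      "\<And>q. q \<in> Q \<Longrightarrow> \<exists>s\<in>P. \<forall>a\<in>P. \<forall>b\<in>P. le s a \<longrightarrow> le s b \<longrightarrow> inf \<bar>x a - x b\<bar> e \<le> q"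
      using Cauchy e unfolding uo_Cauchy_iff[OF P] by blast
    have "\<exists>s\<in>P. \<forall>p\<in>P. le s p \<longrightarrow> inf \<bar>x p - l\<bar> e \<le> q" if q: "q \<in> Q" for q
    proof -
      obtain s where s: "s \<in> P" "\<And>a b. a \<in> P \<Longrightarrow> b \<in> P \<Longrightarrow> le s a \<Longrightarrow> le s b \<Longrightarrow> inf \<bar>x a - x b\<bar> e \<le> q"
        using Q(2)[OF q] by blast
      have "inf \<bar>x p - l\<bar> e \<le> q" if p: "p \<in> P" "le s p" for p
      proof (rule inf_abs_le)
        \<comment> \<open>An element \<open>f\<close> of \<open>A\<close> lies below
          \<open>x p'\<close> for some \<open>p'\<close> beyond \<open>s\<close>, so the excess of
          \<open>f\<close> over \<open>x p\<close> is controlled by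
          \<open>\<bar>x p' - x p\<bar>\<close>. The supremum \<open>l\<close> inherits the
          estimate.\<close>
        have "inf (pprt (l - x p)) e \<le> q"
        proof (rule isLub_inf_pprt_le[OF l])
          show "A \<noteq> {}" using A_dir by (simp add: upward_directed_def)
          fix f assume "f \<in> A"
          then obtain t where t: "t \<in> P" "\<And>p. p \<in> P \<Longrightarrow> le t p \<Longrightarrow> f \<le> x p" by (auto simp: A_def)
          obtain p' where p': "p' \<in> P" "le s p'" "le t p'" using directed_indexD(4)[OF P s(1) t(1)] by blast
          have "pprt (f - x p) \<le> pprt (x p' - x p)" using t(2)[OF p'(1,3)] by (intro pprt_mono) simp
          also have "\<dots> \<le> \<bar>x p' - x p\<bar>" by (simp add: pprt_def abs_ge_self)
          finally have "inf (pprt (f - x p)) e \<le> inf \<bar>x p' - x p\<bar> e" by (intro inf_mono) auto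
          also have "\<dots> \<le> q" by (rule s(2)[OF p'(1) p(1) p'(2) p(2)])
          finally show "inf (pprt (f - x p)) e \<le> q" .
        qed
        then show "inf (pprt (- (x p - l))) e \<le> q" by simp
        \<comment> \<open>With \<open>b\<close> the supremum of \<open>?N\<close>,
          \<open>- b\<close> is the infimum of the tail in the universal completion. Its minorants
          from \<open>'f\<close> belong to \<open>A\<close>, so \<open>- b \<le> J l\<close>.
          Working with negatives lets the estimate for suprema cover this half as well.\<close>
        let ?N = "{- J (x p') | p'. p' \<in> P \<and> le s p'}"
        have Nne: "?N \<noteq> {}" using p by blast
        have N0: "y \<le> 0" if "y \<in> ?N" for y using that x(1) by (auto simp: J_ge_0_iff)
        then obtain b where b: "isLub UNIV ?N b"
          using dedekind_complete_lub[OF J_dedekind Nne, of 0] by blast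
        have b0: "b \<le> 0" using b N0 unfolding isLub_UNIV_iff by blast
        have "J f \<le> J l" if f: "0 \<le> f" "J f \<le> - b" for f
        proof -
          have "f \<le> x p'" if "p' \<in> P" "le s p'" for p'
          proof -
            have "- J (x p') \<le> b" using b that by (auto simp: isLub_UNIV_iff)
            then have "J f \<le> J (x p')" using f(2) by (metis minus_le_iff order_trans)
            then show ?thesis by (simp add: J_le_iff)
          qed
          then have "f \<in> A" using f(1) s(1) by (auto simp: A_def)
          then show ?thesis using l by (auto simp: isLub_UNIV_iff J_le_iff)
        qed
        then have "\<forall>a\<in>J ` {f. 0 \<le> f \<and> J f \<le> - b}. a \<le> J l" by auto
        moreover have "isLub UNIV (J ` {f. 0 \<le> f \<and> J f \<le> - b}) (- b)"
          using b0 by (intro isLub_minorants) simp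
        ultimately have "- b \<le> J l" unfolding isLub_UNIV_iff by blast
        then have "- J l \<le> b" by (simp add: minus_le_iff)
        then have "- J l + J (x p) \<le> b + J (x p)" by (rule add_right_mono)
        then have "pprt (J (x p - l)) \<le> pprt (b - (- J (x p)))"
          by (intro pprt_mono) (simp add: J_diff)
        then have "inf (pprt (J (x p - l))) (J e) \<le> inf (pprt (b - (- J (x p)))) (J e)"
          by (intro inf_mono) auto
        also have "\<dots> \<le> J q"
        proof (rule isLub_inf_pprt_le[OF b Nne])
          fix a assume "a \<in> ?N"
          then obtain p' where p': "p' \<in> P" "le s p'" "a = - J (x p')" by blast
          have "pprt (a - - J (x p)) \<le> \<bar>J (x p) - J (x p')\<bar>"
            unfolding p' by (simp add: pprt_def abs_ge_self)
          then have "inf (pprt (a - - J (x p))) (J e) \<le> inf \<bar>J (x p) - J (x p')\<bar> (J e)"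
            by (intro inf_mono) auto
          also have "\<dots> = J (inf \<bar>x p - x p'\<bar> e)" by (simp add: J_inf J_abs J_diff)
          also have "\<dots> \<le> J q" using s(2)[OF p(1) p'(1) p(2) p'(2)] by (simp only: J_le_iff)
          finally show "inf (pprt (a - - J (x p))) (J e) \<le> J q" .
        qed
        finally have "J (inf (pprt (x p - l)) e) \<le> J q" by (simp add: J_inf J_pprt)
        then show "inf (pprt (x p - l)) e \<le> q" by (simp only: J_le_iff)
      qed
      then show ?thesis using s(1) by blast
    qed
    then show "\<exists>Q. decreases_to_zero Q \<and> (\<forall>q\<in>Q. \<exists>s\<in>P. \<forall>p\<in>P. le s p \<longrightarrow> inf \<bar>x p - l\<bar> e \<le> q)"
      using Q(1) by blast
  qed
  then show thesis using that l A_dir by blast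
qed

lemma uo_Cauchy_limit:
  fixes x :: "'i \<Rightarrow> 'f"
  assumes mc: "monotonically_complete r TYPE('f)" 
    and P: "directed_index P le" and x: "x ` P \<subseteq> cball 0 1" and Cauchy: "uo_Cauchy P le x"
  shows "\<exists>l\<in>cball 0 r. uo_converges P le x l"
proof -
  have pprt_le: "pprt y \<le> \<bar>y\<bar>" "pprt (- y) \<le> \<bar>y\<bar>" for y :: 'f
    by (auto simp: pprt_def abs_ge_self abs_ge_minus_self)
  have n: "norm (x p) \<le> 1" if "p \<in> P" for p using x that by auto
  have n1: "norm (pprt (x p)) \<le> 1" "norm (pprt (- x p)) \<le> 1" if "p \<in> P" for p
    using norm_mono_pos[OF zero_le_pprt pprt_le(1), of "x p"] norm_mono_pos[OF zero_le_pprt pprt_le(2), of "x p"]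
      n[OF that] by (simp_all add: norm_abs_eq)
  have "uo_Cauchy P le (\<lambda>p. pprt (x p))"
    unfolding pprt_def by (rule uo_Cauchy_mono[OF P Cauchy]) (rule abs_sup_sup_le)
  moreover define A where "A = {f. 0 \<le> f \<and> (\<exists>s\<in>P. \<forall>p\<in>P. le s p \<longrightarrow> f \<le> pprt (x p))}"
  ultimately obtain a where a: "isLub UNIV A a" "uo_converges P le (\<lambda>p. pprt (x p)) a" "upward_directed A"
    using uo_Cauchy_positive_limit[OF mc P, of "\<lambda>p. pprt (x p)" A] n1 by auto
  have "\<bar>pprt (- x p) - pprt (- x q)\<bar> \<le> \<bar>x p - x q\<bar>" for p q
    using abs_sup_sup_le[of "- x p" 0 "- x q"] by (simp add: pprt_def abs_minus_commute)
  then have "uo_Cauchy P le (\<lambda>p. pprt (- x p))" by (rule uo_Cauchy_mono[OF P Cauchy])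
  moreover define B where "B = {f. 0 \<le> f \<and> (\<exists>s\<in>P. \<forall>p\<in>P. le s p \<longrightarrow> f \<le> pprt (- x p))}"
  ultimately obtain b where b: "isLub UNIV B b" "uo_converges P le (\<lambda>p. pprt (- x p)) b" "upward_directed B"
    using uo_Cauchy_positive_limit[OF mc P, of "\<lambda>p. pprt (- x p)" B] n1 by auto
  have "pprt y - pprt (- y) = y" for y :: 'f using prts[of y] by (simp add: pprt_neg)
  then have conv: "uo_converges P le x (a - b)" using uo_converges_diff[OF P a(2) b(2)] by simp
  \<comment> \<open>Separate estimates of \<open>a\<close> and \<open>b\<close> would bound the norm
    of \<open>a - b\<close> only by \<open>2 * r\<close>. A sum of an eventual minorant of the
    positive parts and one of the negative parts lies below some \<open>\<bar>x p\<bar>\<close>, so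
    the directed set of these sums bounds \<open>a + b\<close>, and with it
    \<open>\<bar>a - b\<bar>\<close>, by an element of norm at most \<open>r\<close>.\<close>
  let ?C = "{f + g | f g. f \<in> A \<and> g \<in> B}"
  have "upward_directed ?C" unfolding upward_directed_def
  proof (intro conjI ballI)
    show "?C \<noteq> {}" using a(3) b(3) by (auto simp: upward_directed_def)
    fix c d assume "c \<in> ?C" "d \<in> ?C"
    then obtain f g f' g' where f: "c = f + g" "d = f' + g'" "f \<in> A" "g \<in> B" "f' \<in> A" "g' \<in> B" by blast
    obtain h k where "h \<in> A" "f \<le> h" "f' \<le> h" "k \<in> B" "g \<le> k" "g' \<le> k"
      using a(3) b(3) f unfolding upward_directed_def by blast
    then have "h + k \<in> ?C" "c \<le> h + k" "d \<le> h + k" unfolding f(1,2) by (auto intro: add_mono)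
    then show "\<exists>t\<in>?C. c \<le> t \<and> d \<le> t" by blast
  qed
  moreover have "?C \<subseteq> cball 0 1 \<inter> {0..}"
  proof
    fix c assume "c \<in> ?C"
    then obtain f g s t where f: "c = f + g" "0 \<le> f" "0 \<le> g" "s \<in> P" "t \<in> P"
      "\<And>p. p \<in> P \<Longrightarrow> le s p \<Longrightarrow> f \<le> pprt (x p)" "\<And>p. p \<in> P \<Longrightarrow> le t p \<Longrightarrow> g \<le> pprt (- x p)"
      by (auto simp: A_def B_def)
    obtain p where p: "p \<in> P" "le s p" "le t p" using directed_indexD(4)[OF P f(4,5)] by blast
    have "c \<le> pprt (x p) + pprt (- x p)" unfolding f(1) using f(6,7) p by (intro add_mono) auto
    also have "\<dots> = \<bar>x p\<bar>" by (simp add: abs_prts pprt_neg)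
    finally have "norm c \<le> 1" 
      using norm_mono_pos[of c "\<bar>x p\<bar>"] n[OF p(1)] f(1-3) by (simp add: norm_abs_eq)
    then show "c \<in> cball 0 1 \<inter> {0..}" using f(1-3) by simp
  qed
  ultimately obtain t where t: "isLub UNIV ?C t" "norm t \<le> r" using mc by (auto simp: monotonically_complete_def)
  have "a + b \<le> t" by (rule isLub_add[OF a(1) b(1)]) (use t(1) in \<open>auto simp: isLub_UNIV_iff\<close>)
  moreover have "0 \<le> a"
  proof -
    obtain f where f: "f \<in> A" using a(3) by (auto simp: upward_directed_def)
    then have "0 \<le> f" by (simp add: A_def)
    also have "f \<le> a" using a(1) f by (simp add: isLub_UNIV_iff)
    finally show ?thesis .
  qed
  moreover have "0 \<le> b"
  proof -
    obtain f where f: "f \<in> B" using b(3) by (auto simp: upward_directed_def)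
    then have "0 \<le> f" by (simp add: B_def)
    also have "f \<le> b" using b(1) f by (simp add: isLub_UNIV_iff)
    finally show ?thesis .
  qed
  ultimately have "\<bar>a - b\<bar> \<le> t" using abs_triangle_ineq4[of a b] by simp
  also have "\<dots> \<le> \<bar>t\<bar>" by (rule abs_ge_self)
  finally have "\<bar>a - b\<bar> \<le> \<bar>t\<bar>" .
  then have "norm (a - b) \<le> r" using norm_solid t(2) by (meson order_trans)
  then show ?thesis using conv by (intro bexI[of _ "a - b"]) auto
qed

end

section \<open>Suprema of disjoint sets\<close>

lemma inf_sum_disjoint:
  fixes b :: "'i \<Rightarrow> 'a::vector_lattice"
  assumes "\<And>i. i \<in> I \<Longrightarrow> inf (b i) x = 0" "0 \<le> x"
  shows "inf (sum b I) x = 0"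
  using assms(1)
proof (induction I rule: infinite_finite_induct)
  case (insert i I)
  have b0: "0 \<le> b k" if "k \<in> insert i I" for k using insert.prems[OF that] by (metis inf_le1)
  have sum0: "0 \<le> sum b I" using b0 by (intro sum_nonneg) auto
  show ?case
  proof (rule antisym)
    have "inf (b i + sum b I) x \<le> inf (b i) x + inf (sum b I) x"
      using b0 sum0 assms(2) by (intro inf_add_le) auto
    also have "\<dots> = 0" using insert by simp
    finally show "inf (sum b (insert i I)) x \<le> 0" using insert.hyps by simp
    have "0 \<le> sum b (insert i I)" using b0 by (intro sum_nonneg)
    then show "0 \<le> inf (sum b (insert i I)) x" using assms(2) by simp
  qed
qed (use assms(2) in \<open>auto simp: inf_absorb1\<close>)

text \<open>Disjointness makes the sum of a new element and the earlier ones equal to their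
  supremum. The bound \<open>0 \<le> s\<close> covers the empty sum.\<close>

lemma sum_disjoint_le:
  fixes b :: "'i \<Rightarrow> 'a::vector_lattice"
  assumes "finite I" "\<And>i. i \<in> I \<Longrightarrow> 0 \<le> b i" "\<And>i. i \<in> I \<Longrightarrow> b i \<le> s" "0 \<le> s"
    and "\<And>i j. i \<in> I \<Longrightarrow> j \<in> I \<Longrightarrow> i \<noteq> j \<Longrightarrow> inf (b i) (b j) = 0"
  shows "sum b I \<le> s"
  using assms
proof (induction I)
  case (insert i I)
  have "inf (b j) (b i) = 0" if "j \<in> I" for j
  proof (rule insert.prems(4))
    show "j \<noteq> i" using that insert.hyps by blast
  qed (use that in auto)
  then have "inf (sum b I) (b i) = 0" using insert.prems(1) by (intro inf_sum_disjoint) auto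
  then have "b i + sum b I = sup (b i) (sum b I)"
    using add_eq_inf_sup[of "b i" "sum b I"] by (simp add: inf_commute[of "b i"])
  also have "\<dots> \<le> s"
  proof (rule le_supI)
    show "sum b I \<le> s"
    proof (rule insert.IH)
      show "inf (b j) (b k) = 0" if "j \<in> I" "k \<in> I" "j \<noteq> k" for j k
        by (rule insert.prems(4)) (use that in auto)
    qed (use insert.prems in auto)
  qed (use insert.prems in auto)
  finally show ?case using insert.hyps by simp
qed simp

text \<open>
  Viewed as functions, \<open>a k\<close> is \<open>d\<close> times a function of \<open>f / d\<close> that rises linearly from \<open>0\<close> at
  \<open>2^(-k-1)\<close> to \<open>1\<close> at \<open>2^(-k)\<close>. So the \<open>a k\<close> increase to the projection of \<open>d\<close> onto the band of
  \<open>f\<close>, and increments whose indices differ by at least two are disjoint.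
\<close>
lemma disjoint_approximants:
  fixes d f :: "'a::vector_lattice"
  assumes d: "0 \<le> d" "0 \<le> f" and a_def: "a = (\<lambda>k::nat. inf d (pprt ((2^Suc k) *\<^sub>R f - d)))"
  shows "0 \<le> a k" "a k \<le> d" "a k \<le> (2^Suc k) *\<^sub>R f" "mono a" "inf (pprt (d - a (Suc k))) (a k) = 0"
proof -
  have f: "0 \<le> (2^Suc k) *\<^sub>R f" for k using d by (simp add: scaleR_nonneg_nonneg)
  show a0: "0 \<le> a k" and "a k \<le> d" using d by (auto simp: a_def)
  have "pprt ((2^Suc k) *\<^sub>R f - d) \<le> (2^Suc k) *\<^sub>R f" using d f[of k] by (simp add: pprt_def)
  then show "a k \<le> (2^Suc k) *\<^sub>R f" unfolding a_def by (rule le_infI2)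
  show "mono a" unfolding a_def
  proof (intro monoI inf_mono pprt_mono diff_right_mono scaleR_right_mono order_refl power_increasing)
  qed (use d in auto)
  define y where "y = (2^Suc k) *\<^sub>R f"
  have y2: "(2^Suc (Suc k)) *\<^sub>R f = y + y" unfolding y_def by (simp flip: scaleR_add_left)
  \<comment> \<open>The remainder \<open>d - a (Suc k)\<close> lives where \<open>y\<close> is below
    \<open>d\<close>, and \<open>a k\<close> lives where \<open>y\<close> is above \<open>d\<close>.
    They are disjoint because the positive and negative parts of \<open>d - y\<close> are.\<close>
  have "d - a (Suc k) \<le> 2 *\<^sub>R pprt (d - y)"
  proof -
    have "d - a (Suc k) = pprt (d - pprt (y + y - d))"
      unfolding a_def y2 by (rule diff_inf_eq_pprt)
    also have "\<dots> \<le> pprt (2 *\<^sub>R (d - y))"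
    proof (rule pprt_mono)
      have "d - pprt (y + y - d) \<le> d - (y + y - d)" by (intro diff_left_mono) (simp add: pprt_def)
      then show "d - pprt (y + y - d) \<le> 2 *\<^sub>R (d - y)" by (simp add: scaleR_2 algebra_simps)
    qed
    also have "\<dots> \<le> 2 *\<^sub>R pprt (d - y)"
    proof -
      have "d - y \<le> pprt (d - y)" by (simp add: pprt_def)
      then have "2 *\<^sub>R (d - y) \<le> 2 *\<^sub>R pprt (d - y)" by (intro scaleR_left_mono) auto
      then show ?thesis by (simp add: pprt_def[of "2 *\<^sub>R (d - y)"] scaleR_nonneg_nonneg)
    qed
    finally show ?thesis .
  qed
  moreover have "0 \<le> d - a (Suc k)" by (simp add: a_def)
  moreover have "a k \<le> pprt (- (d - y))" by (simp add: a_def y_def)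
  moreover have "inf (2 *\<^sub>R pprt (d - y)) (pprt (- (d - y))) = 0"
    using inf_scaleR_eq_0[of "pprt (- (d - y))" "pprt (d - y)" 2] inf_pprt_pprt_neg[of "d - y"]
    by (simp add: inf_commute)
  ultimately show "inf (pprt (d - a (Suc k))) (a k) = 0"
    using a0 by (simp add: disjoint_mono[of "2 *\<^sub>R pprt (d - y)" "pprt (- (d - y))"])
qed

text \<open>Increments of the sequence are disjoint when their indices are distinct and of equal
  parity, and their finite suprema stay below \<open>d\<close>. Hence the even and the odd
  increments each have a supremum, and these two add up to the supremum of the sequence.\<close>

lemma disjoint_complete_principal_projection:
  fixes d f :: "'f::normed_lattice"
  assumes disj: "\<And>D :: 'f set. D \<noteq> {} \<Longrightarrow> disjoint_positive D \<Longrightarrow> finite_sups D \<subseteq> cball 0 1 \<Longrightarrow> \<exists>s. isLub UNIV D s"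
    and d: "0 \<le> d" "0 \<le> f" "norm d \<le> 1"
  shows "\<exists>e. isLub UNIV (range (\<lambda>k::nat. inf d (pprt ((2^Suc k) *\<^sub>R f - d)))) e"
proof -
  define a where "a = (\<lambda>k::nat. inf d (pprt ((2^Suc k) *\<^sub>R f - d)))"
  note a = disjoint_approximants[OF d(1,2) a_def]
  define b where "b k = (case k of 0 \<Rightarrow> a 0 | Suc k \<Rightarrow> a (Suc k) - a k)" for k
  have b0: "0 \<le> b k" for k using a(1) monoD[OF a(4)] by (auto simp: b_def split: nat.split)
  have ba: "b k \<le> a k" for k using a(1) by (auto simp: b_def split: nat.split)
  have bd: "b k \<le> d" for k using ba a(2) by (rule order_trans)
  have a_sum: "a n = sum b {..n}" for n by (induction n) (auto simp: b_def)
  have b_disj': "inf (b k) (b j) = 0" if jk: "Suc j < k" for j k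
  proof -
    obtain i where i: "k = Suc i" "Suc j \<le> i" using jk by (cases k) auto
    have "b k \<le> d - a (Suc j)" using a(2)[of k] monoD[OF a(4) i(2)] by (auto simp: b_def i(1) intro: diff_mono)
    also have "\<dots> \<le> pprt (d - a (Suc j))" by (simp add: pprt_def)
    finally show ?thesis using disjoint_mono[OF a(5)[of j] b0 _ b0 ba] by blast
  qed
  have b_disj: "inf (b k) (b j) = 0" if "k \<noteq> j" "even k \<longleftrightarrow> even j" for j k
  proof -
    have "Suc j < k \<or> Suc k < j" using that by (metis even_Suc linorder_neqE_nat Suc_lessI)
    then show ?thesis using b_disj' by (metis inf_commute)
  qed
  have sups: "\<exists>s. isLub UNIV (b ` K) s" if K: "K \<noteq> {}" "\<And>j k. j \<in> K \<Longrightarrow> k \<in> K \<Longrightarrow> even j \<longleftrightarrow> even k" for K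
  proof (rule disj)
    show "b ` K \<noteq> {}" using K by simp
    show "disjoint_positive (b ` K)" unfolding disjoint_positive_def pairwise_def
    proof (intro conjI ballI impI)
      fix x y assume "x \<in> b ` K" "y \<in> b ` K" "x \<noteq> y"
      then obtain j k where "x = b j" "y = b k" "j \<in> K" "k \<in> K" "j \<noteq> k" by auto
      then show "inf x y = 0" using b_disj K(2) by blast
    qed (use b0 in auto)
    show "finite_sups (b ` K) \<subseteq> cball 0 1"
    proof
      fix x assume "x \<in> finite_sups (b ` K)"
      then obtain B where B: "x = Sup_fin B" "B \<subseteq> b ` K" "finite B" "B \<noteq> {}" by (auto simp: finite_sups_def)
      then obtain y where y: "y \<in> B" by blast
      have "x \<le> d" unfolding B(1) using B bd by (intro Sup_fin.boundedI) auto
      moreover have "y \<le> x" unfolding B(1) using B y by (intro Sup_fin.coboundedI) auto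
      moreover have "0 \<le> y" using y B(2) b0 by auto
      ultimately have "norm x \<le> norm d" by (intro norm_mono_pos) auto
      then show "x \<in> cball 0 1" using d(3) by simp
    qed
  qed
  have "\<exists>s. isLub UNIV (b ` {k. even k}) s" by (rule sups) (auto intro: exI[of _ 0])
  then obtain s where s: "isLub UNIV (b ` {k. even k}) s" by (rule exE)
  have "\<exists>t. isLub UNIV (b ` {k. odd k}) t" by (rule sups) (auto intro: exI[of _ 1])
  then obtain t where t: "isLub UNIV (b ` {k. odd k}) t" by (rule exE)
  have bs: "b k \<le> s" if "even k" for k using s that by (auto simp: isLub_UNIV_iff)
  have bt: "b k \<le> t" if "odd k" for k using t that by (auto simp: isLub_UNIV_iff)
  have "isLub UNIV (range a) (s + t)"
  proof (unfold isLub_UNIV_iff, intro conjI ballI allI impI)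
    fix x assume "x \<in> range a"
    then obtain n where n: "x = a n" by auto
    have "x = sum b {k \<in> {..n}. even k} + sum b {k \<in> {..n}. odd k}"
      unfolding n a_sum by (subst sum.union_disjoint[symmetric]) (auto intro: sum.cong)
    also have "\<dots> \<le> s + t"
      using bs bt b0 b_disj order_trans[OF b0[of 0] bs[of 0]] order_trans[OF b0[of 1] bt[of 1]]
      by (intro add_mono sum_disjoint_le) auto
    finally show "x \<le> s + t" .
  next
    fix z assume z: "\<forall>x\<in>range a. x \<le> z"
    show "s + t \<le> z"
    \<comment> \<open>An even and an odd index differ, so the two increments are distinct terms of
      the sum \<open>a (max j k)\<close>.\<close>
    proof (rule isLub_add[OF s t])
      fix x y assume "x \<in> b ` {k. even k}" "y \<in> b ` {k. odd k}"
      then obtain j k where jk: "x = b j" "y = b k" "even j" "odd k" by auto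
      then have "x + y = sum b {j, k}" by (subst sum.insert) auto
      also have "\<dots> \<le> sum b {..max j k}" using b0 by (intro sum_mono2) auto
      also have "\<dots> \<le> z" using z by (simp flip: a_sum)
      finally show "x + y \<le> z" .
    qed
  qed
  then show ?thesis unfolding a_def by blast
qed

section \<open>Approximating suprema of directed sets by suprema of disjoint sets\<close>

lemma upward_directed_finite_bound:
  assumes D: "upward_directed D" and "finite B" "\<And>b. b \<in> B \<Longrightarrow> \<exists>d\<in>D. b \<le> d"
  shows "\<exists>d\<in>D. \<forall>b\<in>B. b \<le> d"
  using assms(2,3)
proof (induction B)
  case (insert b B)
  obtain d where d: "d \<in> D" "\<forall>b\<in>B. b \<le> d" using insert by auto
  obtain d' where d': "d' \<in> D" "b \<le> d'" using insert.prems by auto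
  obtain e where "e \<in> D" "d \<le> e" "d' \<le> e" using D d d' unfolding upward_directed_def by blast
  then show ?case using d d' by (intro bexI[of _ e]) (auto intro: order_trans)
qed (use D in \<open>auto simp: upward_directed_def\<close>)

context normed_universal_completion
begin

lemma disjoint_complete_approximation:
  assumes disj: "\<And>D :: 'f set. D \<noteq> {} \<Longrightarrow> disjoint_positive D \<Longrightarrow> finite_sups D \<subseteq> cball 0 1 \<Longrightarrow> 
      \<exists>s. isLub UNIV D s \<and> norm s \<le> r"
    and D: "upward_directed D" "D \<subseteq> cball 0 1 \<inter> {0..}" and u: "isLub UNIV (J ` D) u"
    and t: "0 \<le> t" "t < 1"
  shows "\<exists>v. norm v \<le> r \<and> t *\<^sub>R u \<le> J v \<and> J v \<le> u"
proof -
  have Dne: "D \<noteq> {}" using D(1) by (simp add: upward_directed_def)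
  have Du: "J d \<le> u" if "d \<in> D" for d using u that by (auto simp: isLub_UNIV_iff)
  obtain d0 where d0: "d0 \<in> D" using Dne by blast
  have u0: "0 \<le> u" using Du[OF d0] D(2) d0 by (metis IntD2 J_ge_0_iff atLeast_iff order_trans subsetD)
  define c where "c = t *\<^sub>R u"
  have c0: "0 \<le> c" using t u0 by (simp add: c_def scaleR_nonneg_nonneg)
  have cu: "c \<le> u" using t u0 scaleR_right_mono[of t 1 u] by (simp add: c_def)
  \<comment> \<open>the last condition says that \<open>J m\<close> dominates \<open>c\<close> on its own band\<close>
  define S where "S = {m. 0 < m \<and> (\<exists>d\<in>D. m \<le> d) \<and> (\<forall>k::nat. inf c (of_nat k *\<^sub>R J m) \<le> J m)}"
  obtain M where M: "M \<subseteq> S" "pairwise (\<lambda>a b. inf a b = 0) M"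
    and max: "\<And>x. x \<in> S \<Longrightarrow> (\<And>m. m \<in> M \<Longrightarrow> inf x m = 0) \<Longrightarrow> x \<in> M"
    using maximal_disjoint_subset[of S] by blast
  have M0: "0 \<le> m" if "m \<in> insert 0 M" for m using that M(1) by (auto simp: S_def intro: less_imp_le)
  have MD: "\<exists>d\<in>D. m \<le> d" if "m \<in> insert 0 M" for m using that M(1) d0 D(2) by (auto simp: S_def)
  \<comment> \<open>\<open>disj\<close> speaks of nonempty sets while \<open>M\<close> may be empty.
    Adding \<open>0\<close> keeps disjointness and makes the supremum nonnegative.\<close>
  have "disjoint_positive (insert 0 M)"
    unfolding disjoint_positive_def pairwise_insert
    using M0 M(2) by (auto simp: inf_absorb1 inf_absorb2)
  moreover have "finite_sups (insert 0 M) \<subseteq> cball 0 1"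
  proof
    fix x assume "x \<in> finite_sups (insert 0 M)"
    then obtain B where B: "x = Sup_fin B" "B \<subseteq> insert 0 M" "finite B" "B \<noteq> {}"
      unfolding finite_sups_def by blast
    obtain y where y: "y \<in> B" using B(4) by blast
    obtain d where d: "d \<in> D" "\<forall>b\<in>B. b \<le> d"
      using upward_directed_finite_bound[OF D(1) B(3)] MD B(2) by blast
    have "x \<le> d" unfolding B(1) using B d by (intro Sup_fin.boundedI) auto
    moreover have "y \<le> x" unfolding B(1) using B y by (intro Sup_fin.coboundedI) auto
    moreover have "0 \<le> y" using y B(2) M0 by blast
    ultimately have "norm x \<le> norm d" by (intro norm_mono_pos) auto
    then show "x \<in> cball 0 1" using D(2) d(1) by fastforce
  qed
  ultimately obtain v where v: "isLub UNIV (insert 0 M) v" "norm v \<le> r" using disj[of "insert 0 M"] by blast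
  have Mv: "m \<le> v" if "m \<in> M" for m using v(1) that by (auto simp: isLub_UNIV_iff)
  have v0: "0 \<le> v" using v(1) by (auto simp: isLub_UNIV_iff)
  have "J m \<le> u" if "m \<in> insert 0 M" for m
    using MD[OF that] Du by (meson J_le_iff order_trans)
  then have Jvu: "J v \<le> u" using isLub_image[OF v(1)] unfolding isLub_UNIV_iff by blast
  have "c \<le> J v"
  proof (rule ccontr)
    assume "\<not> c \<le> J v"
    then have g0: "0 < pprt (c - J v)" by (rule pprt_pos)
    \<comment> \<open>The part of \<open>c\<close> that \<open>J v\<close> misses is disjoint from
      \<open>M\<close>. A member of \<open>S\<close> whose image lies in the band of
      \<open>g\<close> will contradict maximality.\<close>
    define g where "g = pprt (c - J v)"
    have gc: "g \<le> c" using c0 v0 by (simp add: g_def pprt_def J_ge_0_iff)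
    have gM: "inf g (J m) = 0" if m: "m \<in> M" for m
      unfolding g_def
    proof (rule disjoint_excess[OF J_dedekind c0])
      show "0 \<le> J m" using M0 m by (simp add: J_ge_0_iff)
      fix k :: nat
      have "inf c (of_nat k *\<^sub>R J m) \<le> J m" using m M(1) by (auto simp: S_def)
      also have "\<dots> \<le> J v" using Mv[OF m] by (simp add: J_le_iff)
      finally show "inf c (of_nat k *\<^sub>R J m) \<le> J v" .
    qed
    \<comment> \<open>Some \<open>d\<close> exceeds \<open>c\<close> on part of the band of
      \<open>g\<close>. Otherwise \<open>u - c\<close>, which is \<open>1 - t\<close> times
      \<open>u\<close> and so dominates \<open>(1 - t) *\<^sub>R g\<close>, would be disjoint from
      \<open>g\<close>.\<close>
    have "\<exists>d\<in>D. \<not> inf (pprt (J d - c)) g \<le> 0"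
    proof (rule ccontr)
      assume "\<not> (\<exists>d\<in>D. \<not> inf (pprt (J d - c)) g \<le> 0)"
      then have le: "inf (pprt (u - c)) g \<le> 0"
        using Dne by (intro isLub_inf_pprt_le[OF u]) auto
      have uc_eq: "u - c = (1 - t) *\<^sub>R u" by (simp add: c_def algebra_simps)
      have "(1 - t) *\<^sub>R g \<le> (1 - t) *\<^sub>R u" using t gc cu by (intro scaleR_left_mono) auto
      also have "\<dots> = pprt (u - c)" using cu by (simp flip: uc_eq)
      finally have 1: "(1 - t) *\<^sub>R g \<le> pprt (u - c)" .
      have "(1 - t) *\<^sub>R g \<le> 1 *\<^sub>R g" using t g0 by (intro scaleR_right_mono) (auto simp: g_def)
      then have "(1 - t) *\<^sub>R g \<le> inf (pprt (u - c)) g" using 1 by simp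
      then have le0: "(1 - t) *\<^sub>R g \<le> 0" using le by (rule order_trans)
      have "inverse (1 - t) *\<^sub>R ((1 - t) *\<^sub>R g) \<le> inverse (1 - t) *\<^sub>R 0"
        using le0 t by (intro scaleR_left_mono) auto
      then show False using t g0 by (simp add: g_def)
    qed
    then obtain d where d: "d \<in> D" "\<not> inf (pprt (J d - c)) g \<le> 0" by blast
    then have "0 < inf (pprt (J d - c)) g"
      using g0 by (simp add: less_le_not_le g_def)
    then obtain f where f: "0 < f" "J f \<le> inf (pprt (J d - c)) g" using J_dense by blast
    have d01: "0 \<le> d" "norm d \<le> 1" using d(1) D(2) by auto
    have f0: "0 \<le> f" using f(1) by simp
    have "J f \<le> J d"
    proof -
      have "J f \<le> pprt (J d - c)" using f(2) by simp
      also have "\<dots> \<le> J d" using c0 d01 by (simp add: pprt_def J_ge_0_iff)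
      finally show ?thesis .
    qed
    then have fd: "f \<le> d" by (simp add: J_le_iff)
    define a where "a = (\<lambda>k::nat. inf d (pprt ((2^Suc k) *\<^sub>R f - d)))"
    note a = disjoint_approximants[OF d01(1) f0 a_def]
    have "\<exists>e. isLub UNIV (range a) e" unfolding a_def
      using disj d01 f0 by (intro disjoint_complete_principal_projection) blast+
    then obtain e where e: "isLub UNIV (range a) e" by blast
    have ae: "a k \<le> e" for k using e by (auto simp: isLub_UNIV_iff)
    have ed: "e \<le> d" using e a(2) by (auto simp: isLub_UNIV_iff)
    have e0: "0 \<le> e" using a(1) ae by (rule order_trans)
    \<comment> \<open>If the projection \<open>e\<close> of \<open>d\<close> onto the band of
      \<open>f\<close> were \<open>0\<close>, then \<open>f \<le> d\<close> would be disjoint from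
      each \<open>p\<close>. As \<open>p\<close> lies below a multiple of \<open>f\<close>, it would
      vanish, so all multiples of \<open>f\<close> would stay below \<open>d\<close>.\<close>
    have "e \<noteq> 0"
    proof
      assume "e = 0"
      have le: "(2^Suc k) *\<^sub>R f \<le> d" for k
      proof -
        define p where "p = pprt ((2^Suc k) *\<^sub>R f - d)"
        have "a k = 0" using a(1)[of k] ae[of k] \<open>e = 0\<close> by simp
        then have "inf d p = 0" by (simp add: a_def p_def)
        then have "inf f p = 0" by (rule disjoint_mono[OF _ f0 fd]) (simp_all add: p_def)
        then have "inf p ((2^Suc k) *\<^sub>R f) = 0" by (intro inf_scaleR_eq_0) (auto simp: inf_commute)
        moreover have "p \<le> (2^Suc k) *\<^sub>R f" using d01 f0 by (simp add: p_def pprt_def scaleR_nonneg_nonneg)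
        ultimately have "p = 0" by (simp add: inf_absorb1)
        then show ?thesis unfolding p_def by (simp flip: le_zero_iff_zero_pprt)
      qed
      have "of_nat n *\<^sub>R J f \<le> J d" for n :: nat
      proof -
        have "real n < 2^n" by (rule of_nat_less_two_power)
        then have "real n \<le> 2^Suc n" unfolding power_Suc by linarith
        then have "of_nat n *\<^sub>R f \<le> (2^Suc n) *\<^sub>R f" using f0 by (intro scaleR_right_mono) auto
        then have "of_nat n *\<^sub>R f \<le> d" using le by (rule order_trans)
        then show ?thesis by (simp add: J_le_iff flip: J_scale)
      qed
      then have "J f \<le> 0" by (rule dedekind_complete_archimedean[OF J_dedekind])
      then show False using f(1) J_le_iff[of f 0] by (simp add: J_0)
    qed
    then have e_pos: "0 < e" using e0 by simp
    have eS_scale: "inf c (of_nat k *\<^sub>R J e) \<le> J e" for k :: nat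
    proof (cases "k = 0")
      case True
      then show ?thesis using e0 by (simp add: J_ge_0_iff le_infI2)
    next
      case False
      \<comment> \<open>\<open>isLub_scaleR_cancel\<close> is applied with the factor
        \<open>1/k\<close>, whence the separate case \<open>k = 0\<close>.\<close>
      let ?A = "(\<lambda>x. of_nat k *\<^sub>R x) ` J ` range a"
      have "(\<lambda>x. inverse (of_nat k) *\<^sub>R x) ` ?A = J ` range a" using False by (simp add: image_image)
      then have "isLub UNIV ((\<lambda>x. inverse (of_nat k) *\<^sub>R x) ` ?A) (J e)" using isLub_image[OF e] by simp
      then have "isLub UNIV ?A (inverse (inverse (of_nat k)) *\<^sub>R J e)"
        using False by (intro isLub_scaleR_cancel) auto
      then have lub: "isLub UNIV ?A (of_nat k *\<^sub>R J e)" by simp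
      have "inf (of_nat k *\<^sub>R J e) c \<le> J e"
      proof (rule isLub_inf_le[OF lub])
        fix x assume "x \<in> ?A"
        then obtain j where j: "x = of_nat k *\<^sub>R J (a j)" by auto
        \<comment> \<open>On the band of \<open>f\<close>, \<open>c\<close> is at most
          \<open>J d\<close>, which replaces \<open>c\<close> by \<open>J d\<close> in the
          truncation. The remainder \<open>d - a (Suc j)\<close> is disjoint from
          \<open>a j\<close>, which then replaces \<open>J d\<close> by
          \<open>J (a (Suc j))\<close>.\<close>
        have "inf (pprt (c - J d)) (pprt (J d - c)) = 0" using inf_pprt_pprt_neg[of "c - J d"] by simp
        then have "inf (pprt (c - J d)) (J f) = 0"
          by (rule disjoint_mono) (use f f0 in \<open>auto simp: J_ge_0_iff\<close>)
        then have "inf (pprt (c - J d)) ((2^Suc j) *\<^sub>R J f) = 0" by (rule inf_scaleR_eq_0) simp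
        then have "inf (pprt (c - J d)) (J (a j)) = 0"
          by (rule disjoint_mono) (use a(1,3)[of j] in \<open>auto simp: J_ge_0_iff J_le_iff simp flip: J_scale\<close>)
        then have "inf c x \<le> J d"
          unfolding j using d01 by (intro inf_scaleR_le_of_disjoint) (auto simp: J_ge_0_iff)
        then have "inf c x \<le> inf (J d) x" by simp
        also have "\<dots> \<le> J (a (Suc j))"
        proof -
          have "inf (pprt (J d - J (a (Suc j)))) (J (a j)) = 0"
            using a(5)[of j] by (simp add: J_0 flip: J_diff J_pprt J_inf)
          then show ?thesis
            unfolding j using a(1) by (intro inf_scaleR_le_of_disjoint) (auto simp: J_ge_0_iff)
        qed
        also have "\<dots> \<le> J e" using ae by (simp add: J_le_iff)
        finally show "inf x c \<le> J e" by (simp add: inf_commute)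
      qed
      then show ?thesis by (simp add: inf_commute)
    qed
    have eS: "e \<in> S" using e_pos ed d(1) eS_scale by (auto simp: S_def)
    have eM: "inf e m = 0" if m: "m \<in> M" for m
    proof (rule antisym)
      show "0 \<le> inf e m" using e0 M0 m by simp
      have "inf (J f) (J m) = 0"
        using gM[OF m] by (rule disjoint_mono) (use f f0 M0 m in \<open>auto simp: J_ge_0_iff\<close>)
      then have "J (inf m f) = J 0" by (simp add: J_inf J_0 inf_commute)
      then have mf: "inf m f = 0" using J_inj by (simp only: inj_eq)
      show "inf e m \<le> 0"
      proof (rule isLub_inf_le[OF e])
        fix x assume "x \<in> range a"
        then obtain k where k: "x = a k" by auto
        have "inf m ((2^Suc k) *\<^sub>R f) = 0" using mf by (rule inf_scaleR_eq_0) simp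
        then have "inf x m \<le> inf m ((2^Suc k) *\<^sub>R f)" using a(3)[of k] unfolding k
          by (metis inf_commute inf_mono order_refl)
        then show "inf x m \<le> 0" by (simp only: \<open>inf m ((2^Suc k) *\<^sub>R f) = 0\<close>)
      qed
    qed
    have "e \<in> M" using max[OF eS eM] .
    then have "inf e e = 0" using eM by blast
    then show False using e_pos by simp
  qed
  then show ?thesis using v(2) Jvu by (auto simp: c_def)
qed

lemma disjoint_complete_imp_dominable_lub:
  assumes comp: "complete (UNIV :: 'f set)"
    and disj: "\<And>D :: 'f set. D \<noteq> {} \<Longrightarrow> disjoint_positive D \<Longrightarrow> finite_sups D \<subseteq> cball 0 1 \<Longrightarrow> 
      \<exists>s. isLub UNIV D s \<and> norm s \<le> r"
    and D: "upward_directed D" "dominable J D" "D \<subseteq> cball 0 1 \<inter> {0..}"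
  shows "\<exists>s. isLub UNIV D s \<and> norm s \<le> r"
proof -
  have Dne: "D \<noteq> {}" using D(1) by (simp add: upward_directed_def)
  then have "J ` D \<noteq> {}" by simp
  then obtain u where u: "isLub UNIV (J ` D) u"
    using D(2) bounded_lub[of "J ` D"] by (auto simp: dominable_def)
  have Du: "J d \<le> u" if "d \<in> D" for d using u that by (auto simp: isLub_UNIV_iff)
  \<comment> \<open>\<open>1 - h n\<close> is the factor \<open>t\<close> of the
    approximation.\<close>
  define h where "h n = (1/2::real)^Suc n" for n :: nat
  have h: "0 < h n" "h n \<le> 1/2" for n
    using power_le_one[of "1/2::real" n] by (auto simp: h_def)
  have "\<exists>v. norm v \<le> r \<and> (1 - h n) *\<^sub>R u \<le> J v \<and> J v \<le> u" for n
    using h[of n] by (intro disjoint_complete_approximation[OF disj D(1,3) u]) auto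
  then obtain v where v: "\<And>n. norm (v n) \<le> r" "\<And>n. (1 - h n) *\<^sub>R u \<le> J (v n)" "\<And>n. J (v n) \<le> u"
    by metis
  \<comment> \<open>As \<open>h 0 = 1/2\<close>, twice \<open>v 0\<close> majorizes
    \<open>u\<close>. This moves the estimate of \<open>v m - v n\<close> from the universal
    completion into \<open>'f\<close>, where the norm lives.\<close>
  have u2: "u \<le> J (2 *\<^sub>R v 0)"
  proof -
    have "2 *\<^sub>R ((1 - h 0) *\<^sub>R u) \<le> 2 *\<^sub>R J (v 0)" using v(2) by (intro scaleR_left_mono) auto
    then show ?thesis by (simp add: h_def J_scale)
  qed
  have diff: "v m - v n \<le> (2 * h n) *\<^sub>R v 0" for m n
  proof -
    have "J (v m) - J (v n) \<le> u - (1 - h n) *\<^sub>R u" using v by (intro diff_mono)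
    also have "\<dots> = h n *\<^sub>R u" by (simp add: algebra_simps)
    also have "\<dots> \<le> h n *\<^sub>R J (2 *\<^sub>R v 0)" using u2 h(1)[of n] by (intro scaleR_left_mono) auto
    also have "\<dots> = J ((2 * h n) *\<^sub>R v 0)" by (simp add: J_scale mult.commute)
    finally show ?thesis by (simp add: J_le_iff flip: J_diff)
  qed
  have v00: "0 \<le> v 0"
  proof -
    obtain d where d: "d \<in> D" using Dne by blast
    then have "0 \<le> J d" using D(3) by (auto simp: J_ge_0_iff)
    then have "0 \<le> J (2 *\<^sub>R v 0)" using Du[OF d] u2 by (meson order_trans)
    then show ?thesis by (simp add: J_ge_0_iff scaleR_2)
  qed
  have dist: "norm (v m - v n) \<le> (1/2)^n * r" if "n \<le> m" for m n
  proof -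
    have "h m \<le> h n" using that unfolding h_def by (intro power_decreasing) auto
    then have "(2 * h m) *\<^sub>R v 0 \<le> (2 * h n) *\<^sub>R v 0" using v00 by (intro scaleR_right_mono) auto
    then have "\<bar>v m - v n\<bar> \<le> (2 * h n) *\<^sub>R v 0"
      using diff[of m n] diff[of n m] by (intro abs_leI) (auto intro: order_trans)
    then have "norm (v m - v n) \<le> norm ((2 * h n) *\<^sub>R v 0)"
      using norm_mono_pos[OF abs_ge_zero] by (metis norm_abs_eq)
    also have "\<dots> = (1/2)^n * norm (v 0)" by (simp add: h_def)
    also have "\<dots> \<le> (1/2)^n * r" using v(1) by (intro mult_left_mono) auto
    finally show ?thesis .
  qed
  have lim0: "(\<lambda>n. (1/2)^n * c) \<longlonglongrightarrow> (0::real)" for c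
    by (intro tendsto_mult_left_zero LIMSEQ_power_zero) simp
  have "Cauchy v"
  proof (rule CauchyI')
    fix e :: real assume "0 < e"
    then obtain n where n: "(1/2)^n * r < e"
      using order_tendstoD(2)[OF lim0, of e r] by (auto simp: eventually_sequentially)
    have r0: "0 \<le> r" using v(1)[of 0] norm_ge_zero by (rule order_trans[rotated])
    have "norm (v i - v j) < e" if "n \<le> i" "i < j" for i j
    proof -
      have "norm (v j - v i) \<le> (1/2)^i * r" using that by (intro dist) simp
      also have "\<dots> \<le> (1/2)^n * r" using that r0 by (intro mult_right_mono power_decreasing) auto
      finally show ?thesis using n by (simp add: norm_minus_commute)
    qed
    then show "\<exists>M. \<forall>i\<ge>M. \<forall>j>i. dist (v i) (v j) < e" by (auto simp: dist_norm)
  qed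
  then obtain s where s: "v \<longlonglongrightarrow> s" using comp unfolding complete_def by blast
  have "isLub UNIV D s"
  proof (unfold isLub_UNIV_iff, intro conjI ballI allI impI)
    fix d assume d: "d \<in> D"
    have "(\<lambda>n. h n *\<^sub>R d) \<longlonglongrightarrow> 0 *\<^sub>R d"
      using lim0[of "1/2"] unfolding h_def by (intro tendsto_scaleR tendsto_const) (simp add: mult.commute)
    then have "(\<lambda>n. v n + h n *\<^sub>R d) \<longlonglongrightarrow> s + 0 *\<^sub>R d" by (intro tendsto_add s)
    then have lim: "(\<lambda>n. v n + h n *\<^sub>R d) \<longlonglongrightarrow> s" by simp
    \<comment> \<open>The image of \<open>v n\<close> dominates the fraction \<open>1 - h n\<close>
      of \<open>u\<close>, hence of \<open>J d\<close>; the remaining fraction tends to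
      \<open>0\<close> in norm.\<close>
    have "d \<le> v n + h n *\<^sub>R d" for n
    proof -
      have "(1 - h n) *\<^sub>R J d \<le> (1 - h n) *\<^sub>R u" using Du[OF d] h(2)[of n] by (intro scaleR_left_mono) auto
      then have "J ((1 - h n) *\<^sub>R d) \<le> J (v n)" using v(2)[of n] unfolding J_scale by (rule order_trans)
      then show ?thesis by (simp add: J_le_iff algebra_simps)
    qed
    then show "d \<le> s" by (intro tendsto_ge_normed_lattice[OF lim]) simp
  next
    fix z assume "\<forall>d\<in>D. d \<le> z"
    then have "u \<le> J z" using u by (auto simp: isLub_UNIV_iff J_le_iff)
    then have "v n \<le> z" for n using v(3)[of n] by (meson J_le_iff order_trans)
    then have "- z \<le> - s" by (intro tendsto_ge_normed_lattice[OF tendsto_minus[OF s]]) simp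
    then show "s \<le> z" by simp
  qed
  moreover have "norm s \<le> r" using v(1) by (intro Lim_norm_ubound[OF _ s]) auto
  ultimately show ?thesis by blast
qed

end

section \<open>Equivalence of the five completeness conditions\<close>

theorem theorem5p7:
  fixes J :: "'f::normed_lattice \<Rightarrow> 'u::vector_lattice"
    and r :: real
  assumes "universal_completion J"
    and "r \<ge> 1"
  shows "(monotonically_complete r TYPE('f) \<longleftrightarrow>
           (\<forall>D :: 'f set. upward_directed D \<and> dominable J D \<and> D \<subseteq> cball 0 1 \<inter> {0..} \<longrightarrow>
              (\<exists>s. isLub UNIV D s \<and> norm s \<le> r)))
       \<and> (monotonically_complete r TYPE('f) \<longleftrightarrow>
           complete (UNIV :: 'f set) \<and>
           (\<forall>D :: 'f set. D \<noteq> {} \<and> disjoint_positive D \<and> finite_sups D \<subseteq> cball 0 1 \<longrightarrow>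
              (\<exists>s. isLub UNIV D s \<and> norm s \<le> r)))
       \<and> (monotonically_complete r TYPE('f) \<longleftrightarrow>
           order_adherence TYPE('i + 'f) (J ` cball 0 1) \<subseteq> J ` cball 0 r)
       \<and> (monotonically_complete r TYPE('f) \<longleftrightarrow>
           (\<forall>(P :: ('i + 'f) set) le x :: 'i + 'f \<Rightarrow> 'f.
              directed_index P le \<and> x ` P \<subseteq> cball 0 1 \<and> uo_Cauchy P le x \<longrightarrow>
              (\<exists>l\<in>cball 0 r. uo_converges P le x l)))"
proof -
  interpret normed_universal_completion J
    by unfold_locales (fact assms(1))
  show ?thesis
  proof (intro conjI iffI)
    assume mc: "monotonically_complete r TYPE('f)"
    show "\<forall>D :: 'f set. upward_directed D \<and> dominable J D \<and> D \<subseteq> cball 0 1 \<inter> {0..} \<longrightarrow>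
              (\<exists>s. isLub UNIV D s \<and> norm s \<le> r)"
      using mc unfolding monotonically_complete_def by blast
    show "complete (UNIV :: 'f set)" using mc by (rule monotonically_complete_imp_complete)
    show "\<forall>D :: 'f set. D \<noteq> {} \<and> disjoint_positive D \<and> finite_sups D \<subseteq> cball 0 1 \<longrightarrow>
              (\<exists>s. isLub UNIV D s \<and> norm s \<le> r)"
      using monotonically_complete_disjoint_lub[OF mc] by blast
    show "order_adherence TYPE('i + 'f) (J ` cball 0 1) \<subseteq> J ` cball 0 r"
      using mc assms(2) by (rule order_adherence_subset)
    show "\<forall>(P :: ('i + 'f) set) le x :: 'i + 'f \<Rightarrow> 'f.
              directed_index P le \<and> x ` P \<subseteq> cball 0 1 \<and> uo_Cauchy P le x \<longrightarrow>
              (\<exists>l\<in>cball 0 r. uo_converges P le x l)"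
      using uo_Cauchy_limit[OF mc] by blast
  next
    assume "\<forall>D :: 'f set. upward_directed D \<and> dominable J D \<and> D \<subseteq> cball 0 1 \<inter> {0..} \<longrightarrow>
              (\<exists>s. isLub UNIV D s \<and> norm s \<le> r)"
    then show "monotonically_complete r TYPE('f)"
      by (intro dominable_lub_imp_monotonically_complete) blast
  next
    assume iii: "complete (UNIV :: 'f set) \<and>
           (\<forall>D :: 'f set. D \<noteq> {} \<and> disjoint_positive D \<and> finite_sups D \<subseteq> cball 0 1 \<longrightarrow>
              (\<exists>s. isLub UNIV D s \<and> norm s \<le> r))"
    show "monotonically_complete r TYPE('f)"
    proof (rule dominable_lub_imp_monotonically_complete)
      fix D :: "'f set" assume "upward_directed D" "dominable J D" "D \<subseteq> cball 0 1 \<inter> {0..}"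
      with iii show "\<exists>s. isLub UNIV D s \<and> norm s \<le> r"
        by (intro disjoint_complete_imp_dominable_lub[of r D]) blast+
    qed
  next
    assume "order_adherence TYPE('i + 'f) (J ` cball 0 1) \<subseteq> J ` cball 0 r"
    from dominable_lub_imp_monotonically_complete[OF order_adherence_imp_dominable_lub[OF this]]
    show "monotonically_complete r TYPE('f)" .
  next
    assume v: "\<forall>(P :: ('i + 'f) set) le x :: 'i + 'f \<Rightarrow> 'f.
              directed_index P le \<and> x ` P \<subseteq> cball 0 1 \<and> uo_Cauchy P le x \<longrightarrow>
              (\<exists>l\<in>cball 0 r. uo_converges P le x l)"
    show "monotonically_complete r TYPE('f)"
    proof (rule dominable_lub_imp_monotonically_complete)
      fix D :: "'f set" assume "upward_directed D" "dominable J D" "D \<subseteq> cball 0 1 \<inter> {0..}"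
      then show "\<exists>s. isLub UNIV D s \<and> norm s \<le> r"
        by (rule uo_complete_imp_dominable_lub[rotated]) (use v in blast)
    qed
  qed
qed

end
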